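(* Let $RL(3,3)$ be the group of invertible linear maps $B$ of $\mathbb R^{3,3}=\Lambda^2(\mathbb R^4)$ satisfying $B^T\mathcal J B=\pm\mathcal J$. The action of $RL(3,3)$ on the set of null 3-spaces of $\mathbb R^{3,3}$ (which represent the points and planes of 3-dimensional projective space) induces a surjective 2-to-1 group homomorphism (a double covering) from $RL(3,3)$ onto the group $PR(3)$ of all 3-dimensional projective transformations and projective polarities.
   Context: Let $e_0,e_1,e_2,e_3$ be the standard basis of $\mathbb R^4$. $\mathbb R^{3,3}$ denotes $\Lambda^2(\mathbb R^4)$ with basis $E_i=e_0\wedge e_i$ ($i=1,2,3$), $E_1'=e_2\wedge e_3$, $E_2'=e_3\wedge e_1$, $E_3'=e_1\wedge e_2$ and the symmetric bilinear form $E_i\cdot E_j'=\delta_{ij}$, $E_i\cdot E_j=E_i'\cdot E_j'=0$; its Gram matrix in the basis $E_1,E_2,E_3,E_1',E_2',E_3'$ is $\mathcal J=\begin{pmatrix}0&I_3\\ I_3&0\end{pmatrix}$. A null 3-space is a 3-dimensional subspace on which the form vanishes identically. A projective point $[X]$ ($0\ne X\in\mathbb R^4$) is represented by the null 3-space $\{X\wedge Y: Y\in\mathbb R^4\}$, and a plane $[\Pi]$ ($0\neq\Pi\in(\mathbb R^4)^*$) is represented by the null 3-space $\Lambda^2(\ker \Pi)$; these are all the null 3-spaces. Projective transformations are given by $A\in GL(4)$ with $\det A=\pm1$, acting by $[X]\mapsto[AX]$ on points and by $[\Pi]\mapsto[A^{-T}\Pi]$ on planes. Projective polarities are given by linear isomorphisms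 $A:\mathbb R^4\to(\mathbb R^4)^*$ with matrix of determinant $\pm1$ (with respect to the standard basis and its dual basis), acting by sending the point $[X]$ to the plane $[AX]$ and the plane $[\Pi]$ to the point $[A^{-T}\Pi]$. $PR(3)$ is the group (under composition) of all projective transformations and projective polarities, two of them being identified when their matrices differ by a nonzero scalar. *)

theory Defs
  imports
    "HOL-Analysis.Analysis"
    "HOL-Algebra.Bij"
    "HOL-Algebra.Group_Action"
begin

section \<open>The exterior square of \<open>\<real>\<^sup>4\<close>\<close>

text \<open>
  \<open>\<real>\<^sup>4\<close> is \<open>real^4\<close>. The index type \<open>4\<close> is the integers modulo 4, so its elements are
  \<open>0, 1, 2, 3\<close> and the basis vector \<open>e\<^sub>i\<close> is \<open>axis i 1\<close>. Likewise the elements of the type \<open>3\<close>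
  are \<open>1, 2, 3\<close> (with \<open>3 = 0\<close>).

  \<open>\<Lambda>\<^sup>2(\<real>\<^sup>4)\<close> is modelled by coordinates with respect to \<open>E\<^sub>1, E\<^sub>2, E\<^sub>3, E\<^sub>1', E\<^sub>2', E\<^sub>3'\<close>.
  The lemma \<open>wedge_universal\<close> below shows that \<open>wedge\<close> has the universal property of the exterior
  square, and \<open>wedge_axis\<close> that the basis vectors are the stated wedge products.
\<close>

type_synonym bivec = "real^(3 + 3)"

definition E :: "3 \<Rightarrow> bivec" where
  "E i = axis (Inl i) 1"

definition E' :: "3 \<Rightarrow> bivec" where
  "E' i = axis (Inr i) 1"

definition wedge :: "real^4 \<Rightarrow> real^4 \<Rightarrow> bivec" where
  "wedge X Y =
     (let p = (\<lambda>i j. X $ i * Y $ j - X $ j * Y $ i) in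
        p 0 1 *\<^sub>R E 1 + p 0 2 *\<^sub>R E 2 + p 0 3 *\<^sub>R E 3
      + p 2 3 *\<^sub>R E' 1 + p 3 1 *\<^sub>R E' 2 + p 1 2 *\<^sub>R E' 3)"

definition Gram :: "real^(3 + 3)^(3 + 3)" where
  "Gram = (\<chi> k l. case (k, l) of
       (Inl i, Inr j) \<Rightarrow> (if i = j then 1 else 0)
     | (Inr i, Inl j) \<Rightarrow> (if i = j then 1 else 0)
     | _ \<Rightarrow> 0)"

definition bform :: "bivec \<Rightarrow> bivec \<Rightarrow> real" where
  "bform u v = u \<bullet> (Gram *v v)"

definition null_three_spaces :: "bivec set set" where
  "null_three_spaces = {N. subspace N \<and> dim N = 3 \<and> (\<forall>u\<in>N. \<forall>v\<in>N. bform u v = 0)}"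


section \<open>Points and planes of projective 3-space\<close>

text \<open>
  The dual space of \<open>\<real>\<^sup>4\<close> is identified with \<open>real^4\<close> by means of the dual basis, the pairing
  being the inner product. The class \<open>[X]\<close> is the line spanned by \<open>X\<close>. The constructors \<open>Point\<close>
  and \<open>Plane\<close> are meaningful on lines only; \<open>proj_elements\<close> is the set of all points and planes.
\<close>

datatype proj = Point "(real^4) set" | Plane "(real^4) set"

definition point_of :: "real^4 \<Rightarrow> proj" where
  "point_of X = Point (span {X})"

definition plane_of :: "real^4 \<Rightarrow> proj" where
  "plane_of P = Plane (span {P})"

definition proj_elements :: "proj set" where
  "proj_elements = {point_of X | X. X \<noteq> 0} \<union> {plane_of P | P. P \<noteq> 0}"

text \<open>
  See \<open>null_space_of_point\<close> and \<open>null_space_of_plane\<close> below for the values on \<open>[X]\<close> and \<open>[\<Pi>]\<close>.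
\<close>

fun null_space_of :: "proj \<Rightarrow> bivec set" where
  "null_space_of (Point l) = {wedge X Y | X Y. X \<in> l}"
| "null_space_of (Plane l) =
     (let K = {X. \<forall>P\<in>l. P \<bullet> X = 0} in span {wedge X Y | X Y. X \<in> K \<and> Y \<in> K})"


section \<open>The group \<open>PR(3)\<close>\<close>

definition inv_transpose :: "real^4^4 \<Rightarrow> real^4^4" where
  "inv_transpose A = transpose (matrix_inv A)"

definition transformation :: "real^4^4 \<Rightarrow> proj \<Rightarrow> proj" where
  "transformation A = (\<lambda>x\<in>proj_elements. case x of
       Point l \<Rightarrow> Point ((*v) A ` l)
     | Plane l \<Rightarrow> Plane ((*v) (inv_transpose A) ` l))"

definition polarity :: "real^4^4 \<Rightarrow> proj \<Rightarrow> proj" where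
  "polarity A = (\<lambda>x\<in>proj_elements. case x of
       Point l \<Rightarrow> Plane ((*v) A ` l)
     | Plane l \<Rightarrow> Point ((*v) (inv_transpose A) ` l))"

text \<open>
  The elements of \<open>PR3\<close> are maps of points and planes, so that the group operation is composition.
  Two transformations, or two polarities, are the same element if and only if their matrices are
  proportional (\<open>transformation_eq_iff\<close>, \<open>polarity_eq_iff\<close>); a transformation is never a polarity
  (\<open>transformation_neq_polarity\<close>).
\<close>

definition PR3 :: "(proj \<Rightarrow> proj) monoid" where
  "PR3 = (BijGroup proj_elements)
     \<lparr>carrier := {transformation A | A. det A = 1 \<or> det A = -1}
               \<union> {polarity A | A. det A = 1 \<or> det A = -1}\<rparr>"


section \<open>The group \<open>RL(3,3)\<close> and its action\<close>

definition RL33 :: "(real^(3 + 3)^(3 + 3)) monoid" where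
  "RL33 = \<lparr>carrier = {B. invertible B \<and>
                        (transpose B ** Gram ** B = Gram \<or> transpose B ** Gram ** B = - Gram)},
           mult = (**),
           one = mat 1\<rparr>"

definition null_action :: "real^(3 + 3)^(3 + 3) \<Rightarrow> bivec set \<Rightarrow> bivec set" where
  "null_action B = (\<lambda>N\<in>null_three_spaces. (*v) B ` N)"

text \<open>
  The action transported from null 3-spaces to points and planes along \<open>null_space_of\<close>.
\<close>

definition induced_map :: "real^(3 + 3)^(3 + 3) \<Rightarrow> proj \<Rightarrow> proj" where
  "induced_map B = (\<lambda>x\<in>proj_elements.
     the_inv_into proj_elements null_space_of (null_action B (null_space_of x)))"


section \<open>Sanity checks for the definitions\<close>

lemma index4_zero: "(0::4) = 4"
  by simp

lemma all4: "(\<forall>i::4. P i) \<longleftrightarrow> P 0 \<and> P 1 \<and> P 2 \<and> P 3"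
  by (auto simp: forall_4 index4_zero simp del: zero_neq_one)

lemma bivec_nth:
  "E i $ Inl j = (if i = j then 1 else 0)" "E i $ Inr j = 0"
  "E' i $ Inr j = (if i = j then 1 else 0)" "E' i $ Inl j = 0"
  by (auto simp: E_def E'_def axis_def)

lemma all33: "(\<forall>k :: 3 + 3. P k) \<longleftrightarrow>
    P (Inl 1) \<and> P (Inl 2) \<and> P (Inl 3) \<and> P (Inr 1) \<and> P (Inr 2) \<and> P (Inr 3)"
  (is "?l \<longleftrightarrow> ?r")
proof
  assume P: "?r"
  show "?l"
  proof
    fix k show "P k"
    proof (cases k)
      case (Inl i) then show ?thesis using P exhaust_3[of i] by auto
    next
      case (Inr i) then show ?thesis using P exhaust_3[of i] by auto
    qed
  qed
qed blast

lemma wedge_axis: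
  "wedge (axis 0 1) (axis 1 1) = E 1"
  "wedge (axis 0 1) (axis 2 1) = E 2"
  "wedge (axis 0 1) (axis 3 1) = E 3"
  "wedge (axis 2 1) (axis 3 1) = E' 1"
  "wedge (axis 3 1) (axis 1 1) = E' 2"
  "wedge (axis 1 1) (axis 2 1) = E' 3"
  by (simp_all add: wedge_def axis_def)

lemma bform_basis:
  "bform (E i) (E j) = 0" "bform (E' i) (E' j) = 0"
  "bform (E i) (E' j) = (if i = j then 1 else 0)"
  "bform (E' i) (E j) = (if i = j then 1 else 0)"
  by (auto simp: bform_def E_def E'_def inner_axis' matrix_vector_mul_component inner_axis Gram_def)

lemma bilinear_wedge: "bilinear wedge"
  unfolding bilinear_def
  by (auto intro!: linearI simp: wedge_def Let_def vec_eq_iff all33 bivec_nth algebra_simps)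

lemma wedge_self: "wedge X X = 0"
  by (simp add: wedge_def)

lemma bivec_expand:
  fixes u :: bivec
  shows "u = u $ Inl 1 *\<^sub>R E 1 + u $ Inl 2 *\<^sub>R E 2 + u $ Inl 3 *\<^sub>R E 3
           + u $ Inr 1 *\<^sub>R E' 1 + u $ Inr 2 *\<^sub>R E' 2 + u $ Inr 3 *\<^sub>R E' 3"
  by (simp add: vec_eq_iff all33 bivec_nth)

lemma vec4_expand:
  fixes X :: "real^4"
  shows "X = X $ 0 *\<^sub>R axis 0 1 + X $ 1 *\<^sub>R axis 1 1 + X $ 2 *\<^sub>R axis 2 1 + X $ 3 *\<^sub>R axis 3 1"
  by (simp add: vec_eq_iff all4 axis_def)

lemma wedge_universal:
  fixes h :: "real^4 \<Rightarrow> real^4 \<Rightarrow> 'a::real_vector"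
  assumes "bilinear h" and alt: "\<And>X. h X X = 0"
  shows "\<exists>!L. linear L \<and> (\<forall>X Y. h X Y = L (wedge X Y))"
proof
  have lin: "linear (h X)" "linear (\<lambda>X. h X Y)" for X Y
    using assms(1) by (auto simp: bilinear_def)
  note h_simps = linear_add[OF lin(1)] linear_add[OF lin(2)] linear_scale[OF lin(1)] linear_scale[OF lin(2)]
  have skew: "h X Y = - h Y X" for X Y
  proof -
    have "h (X + Y) (X + Y) = h X Y + h Y X"
      using alt[of X] alt[of Y] by (simp only: h_simps) simp
    with alt[of "X + Y"] show ?thesis
      by (simp add: eq_neg_iff_add_eq_0)
  qed
  define e :: "4 \<Rightarrow> real^4" where "e = (\<lambda>i. axis i 1)"
  define L where "L = (\<lambda>u :: bivec. u $ Inl 1 *\<^sub>R h (e 0) (e 1) + u $ Inl 2 *\<^sub>R h (e 0) (e 2)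
     + u $ Inl 3 *\<^sub>R h (e 0) (e 3) + u $ Inr 1 *\<^sub>R h (e 2) (e 3) + u $ Inr 2 *\<^sub>R h (e 3) (e 1)
     + u $ Inr 3 *\<^sub>R h (e 1) (e 2))"
  have "linear L"
    by (rule linearI) (simp_all add: L_def algebra_simps)
  moreover have "h X Y = L (wedge X Y)" for X Y
  proof -
    define x where "x = (\<lambda>i. X $ i)"
    define y where "y = (\<lambda>i. Y $ i)"
    have X: "X = x 0 *\<^sub>R e 0 + x 1 *\<^sub>R e 1 + x 2 *\<^sub>R e 2 + x 3 *\<^sub>R e 3"
      using vec4_expand[of X] by (simp add: x_def e_def)
    have Y: "Y = y 0 *\<^sub>R e 0 + y 1 *\<^sub>R e 1 + y 2 *\<^sub>R e 2 + y 3 *\<^sub>R e 3"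
      using vec4_expand[of Y] by (simp add: y_def e_def)
    have "h X Y = h (x 0 *\<^sub>R e 0 + x 1 *\<^sub>R e 1 + x 2 *\<^sub>R e 2 + x 3 *\<^sub>R e 3)
                    (y 0 *\<^sub>R e 0 + y 1 *\<^sub>R e 1 + y 2 *\<^sub>R e 2 + y 3 *\<^sub>R e 3)"
      using X Y by simp
    also have "\<dots> = (x 0 * y 1 - x 1 * y 0) *\<^sub>R h (e 0) (e 1) + (x 0 * y 2 - x 2 * y 0) *\<^sub>R h (e 0) (e 2)
       + (x 0 * y 3 - x 3 * y 0) *\<^sub>R h (e 0) (e 3) + (x 2 * y 3 - x 3 * y 2) *\<^sub>R h (e 2) (e 3)
       + (x 3 * y 1 - x 1 * y 3) *\<^sub>R h (e 3) (e 1) + (x 1 * y 2 - x 2 * y 1) *\<^sub>R h (e 1) (e 2)"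
      using skew[of "e 1" "e 0"] skew[of "e 2" "e 0"] skew[of "e 3" "e 0"]
        skew[of "e 3" "e 2"] skew[of "e 1" "e 3"] skew[of "e 2" "e 1"]
      by (simp add: h_simps alt) (simp add: algebra_simps)
    also have "\<dots> = L (wedge X Y)"
      by (simp add: L_def wedge_def bivec_nth x_def y_def)
    finally show ?thesis .
  qed
  ultimately show "linear L \<and> (\<forall>X Y. h X Y = L (wedge X Y))"
    by blast
  fix M assume M: "linear M \<and> (\<forall>X Y. h X Y = M (wedge X Y))"
  then have lM: "linear M" by blast
  have MB: "M (E 1) = h (e 0) (e 1)" "M (E 2) = h (e 0) (e 2)" "M (E 3) = h (e 0) (e 3)"
    "M (E' 1) = h (e 2) (e 3)" "M (E' 2) = h (e 3) (e 1)" "M (E' 3) = h (e 1) (e 2)"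
    using M by (simp_all add: wedge_axis e_def)
  have "M u = L u" for u
    by (subst bivec_expand[of u])
      (simp add: L_def linear_add[OF lM] linear_scale[OF lM] MB)
  then show "M = L" by blast
qed

lemma null_space_of_point:
  assumes "X \<noteq> 0"
  shows "null_space_of (point_of X) = {wedge X Y | Y. True}"
proof -
  have "wedge (c *\<^sub>R X) Y = wedge X (c *\<^sub>R Y)" for c Y
    by (simp add: bilinear_lmul[OF bilinear_wedge] bilinear_rmul[OF bilinear_wedge])
  moreover have "wedge X Y = wedge (1 *\<^sub>R X) Y" for Y by simp
  ultimately show ?thesis
    unfolding point_of_def null_space_of.simps span_singleton by blast
qed

lemma null_space_of_plane:
  "null_space_of (plane_of P) = span {wedge X Y | X Y. P \<bullet> X = 0 \<and> P \<bullet> Y = 0}"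
proof -
  have "{X. \<forall>Q\<in>span {P}. Q \<bullet> X = 0} = {X. P \<bullet> X = 0}"
    by (auto simp: span_singleton dest: spec[of _ 1])
  then show ?thesis
    unfolding plane_of_def null_space_of.simps Let_def by simp
qed

lemma image_line: "(*v) A ` span {X} = span {A *v X}" for A :: "real^4^4"
  by (simp add: linear_span_image[OF matrix_vector_mul_linear, symmetric])

lemma transformation_point: "X \<noteq> 0 \<Longrightarrow> transformation A (point_of X) = point_of (A *v X)"
  and transformation_plane: "P \<noteq> 0 \<Longrightarrow> transformation A (plane_of P) = plane_of (inv_transpose A *v P)"
  and polarity_point: "X \<noteq> 0 \<Longrightarrow> polarity A (point_of X) = plane_of (A *v X)"
  and polarity_plane: "P \<noteq> 0 \<Longrightarrow> polarity A (plane_of P) = point_of (inv_transpose A *v P)"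
  by (auto simp: transformation_def polarity_def proj_elements_def point_of_def plane_of_def image_line)

lemma span_eq_imp_scaleR:
  fixes a b :: "'a::real_vector"
  assumes "span {a} = span {b}"
  obtains c where "a = c *\<^sub>R b"
proof -
  have "a \<in> span {b}" using assms span_base[of a "{a}"] by simp
  then show thesis using that by (auto simp: span_singleton)
qed

lemma matrix_inv_both:
  assumes "invertible A"
  shows "A ** matrix_inv A = mat 1" "matrix_inv A ** A = mat 1"
  using assms unfolding invertible_def matrix_inv_def by (metis (mono_tags, lifting) someI_ex)+

lemma matrix_inv_eqI:
  assumes "A ** C = mat 1" "C ** A = mat 1"
  shows "matrix_inv A = C"
proof -
  have "invertible A" using assms by (auto simp: invertible_def)
  then have "matrix_inv A ** (A ** C) = C"
    by (simp add: matrix_mul_assoc matrix_inv_both)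
  then show ?thesis by (simp add: assms)
qed

lemma axis_nth': "axis j c $ i = (if i = j then c else 0)"
  by (simp add: axis_def)

lemma proportional_if_same_lines:
  fixes A A' :: "real^4^4"
  assumes inv: "invertible A" and "invertible A'"
    and lines: "\<And>X. X \<noteq> 0 \<Longrightarrow> span {A' *v X} = span {A *v X}"
  shows "\<exists>c. c \<noteq> 0 \<and> A' = c *\<^sub>R A"
proof -
  define C where "C = matrix_inv A ** A'"
  have A': "A' = A ** C"
    using matrix_inv_both[OF inv] by (simp add: C_def matrix_mul_assoc)
  have "\<exists>c. C *v X = c *\<^sub>R X" if X: "X \<noteq> 0" for X
  proof -
    obtain c where "A' *v X = c *\<^sub>R (A *v X)"
      using span_eq_imp_scaleR[OF lines[OF X]] .
    then have "matrix_inv A *v (A' *v X) = c *\<^sub>R (matrix_inv A *v (A *v X))"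
      by (simp add: matrix_vector_mult_scaleR)
    then have "C *v X = c *\<^sub>R X"
      using matrix_inv_both[OF inv] by (simp add: C_def matrix_vector_mul_assoc)
    then show ?thesis ..
  qed
  then obtain f where f: "\<And>X. X \<noteq> 0 \<Longrightarrow> C *v X = f X *\<^sub>R X" by metis
  have ax: "C $ i $ j = (if i = j then f (axis j 1) else 0)" for i j
  proof -
    have "C *v axis j 1 = f (axis j 1) *\<^sub>R axis j 1" by (rule f) (simp add: axis_eq_0_iff)
    then have "(C *v axis j 1) $ i = (f (axis j 1) *\<^sub>R axis j 1) $ i" by simp
    moreover have "(C *v axis j 1) $ i = C $ i $ j"
      by (simp add: matrix_vector_mult_basis column_def)
    ultimately show ?thesis
      by (cases "i = j") (simp_all add: axis_nth')
  qed
  define one :: "real^4" where "one = (\<chi> i. 1)"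
  have "one \<noteq> 0" by (simp add: one_def vec_eq_iff)
  then have "C *v one = f one *\<^sub>R one" by (rule f)
  then have "(C *v one) $ i = f one" for i by (simp add: one_def)
  then have "f (axis i 1) = f one" for i
    by (simp add: matrix_vector_mult_def one_def ax)
  then have "C = f one *\<^sub>R mat 1"
    by (simp add: vec_eq_iff ax mat_def)
  then have eq: "A' = f one *\<^sub>R A"
    using A' by (simp add: scalar_mult_eq_scaleR[symmetric] matrix_scalar_ac)
  moreover have "f one \<noteq> 0"
  proof
    assume "f one = 0"
    with eq have "A' = mat 0" by simp
    then have "det A' = 0" by (simp only: det_0)
    then show False using assms(2) by (simp add: invertible_det_nz)
  qed
  ultimately show ?thesis by blast
qed

lemma inv_transpose_scaleR:
  assumes "invertible A" "c \<noteq> 0"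
  shows "inv_transpose (c *\<^sub>R A) = inverse c *\<^sub>R inv_transpose A"
proof -
  have "matrix_inv (c *\<^sub>R A) = inverse c *\<^sub>R matrix_inv A"
    by (rule matrix_inv_eqI)
      (use assms in \<open>simp_all add: matrix_scalar_ac matrix_inv_both flip: scalar_matrix_assoc\<close>)
  then show ?thesis
    by (simp add: inv_transpose_def transpose_scalar)
qed

lemma span_scaleR_singleton: "c \<noteq> 0 \<Longrightarrow> span {c *\<^sub>R v} = span {v}" for v :: "'a::real_vector"
  using span_image_scale[of "{v}" "\<lambda>_. c"] by simp

lemma point_of_scaleR: "c \<noteq> 0 \<Longrightarrow> point_of (c *\<^sub>R X) = point_of X"
  and plane_of_scaleR: "c \<noteq> 0 \<Longrightarrow> plane_of (c *\<^sub>R X) = plane_of X"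
  by (simp_all add: point_of_def plane_of_def span_scaleR_singleton)

lemma transformation_eq_iff:
  assumes "invertible A" "invertible A'"
  shows "transformation A' = transformation A \<longleftrightarrow> (\<exists>c. c \<noteq> 0 \<and> A' = c *\<^sub>R A)"
proof
  assume eq: "transformation A' = transformation A"
  have "span {A' *v X} = span {A *v X}" if "X \<noteq> 0" for X
    using fun_cong[OF eq, of "point_of X"] that
    by (simp add: transformation_point) (simp add: point_of_def)
  then show "\<exists>c. c \<noteq> 0 \<and> A' = c *\<^sub>R A"
    using proportional_if_same_lines assms by blast
next
  assume "\<exists>c. c \<noteq> 0 \<and> A' = c *\<^sub>R A"
  then obtain c where c: "c \<noteq> 0" "A' = c *\<^sub>R A" by blast
  have "transformation A' x = transformation A x" if "x \<in> proj_elements" for x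
    using that c assms
    by (auto simp: proj_elements_def transformation_point transformation_plane inv_transpose_scaleR
        point_of_scaleR plane_of_scaleR simp flip: scaleR_matrix_vector_assoc)
  then show "transformation A' = transformation A"
    by (intro extensionalityI[of _ proj_elements]) (auto simp: transformation_def)
qed

lemma polarity_eq_iff:
  assumes "invertible A" "invertible A'"
  shows "polarity A' = polarity A \<longleftrightarrow> (\<exists>c. c \<noteq> 0 \<and> A' = c *\<^sub>R A)"
proof
  assume eq: "polarity A' = polarity A"
  have "span {A' *v X} = span {A *v X}" if "X \<noteq> 0" for X
    using fun_cong[OF eq, of "point_of X"] that
    by (simp add: polarity_point) (simp add: plane_of_def)
  then show "\<exists>c. c \<noteq> 0 \<and> A' = c *\<^sub>R A"
    using proportional_if_same_lines assms by blast
next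
  assume "\<exists>c. c \<noteq> 0 \<and> A' = c *\<^sub>R A"
  then obtain c where c: "c \<noteq> 0" "A' = c *\<^sub>R A" by blast
  have "polarity A' x = polarity A x" if "x \<in> proj_elements" for x
    using that c assms
    by (auto simp: proj_elements_def polarity_point polarity_plane inv_transpose_scaleR
        point_of_scaleR plane_of_scaleR simp flip: scaleR_matrix_vector_assoc)
  then show "polarity A' = polarity A"
    by (intro extensionalityI[of _ proj_elements]) (auto simp: polarity_def)
qed

lemma transformation_neq_polarity: "transformation A \<noteq> polarity A'"
proof
  assume eq: "transformation A = polarity A'"
  have "axis 0 1 \<noteq> (0 :: real^4)" by (simp add: axis_eq_0_iff)
  with fun_cong[OF eq, of "point_of (axis 0 1)"] show False
    by (simp add: transformation_point polarity_point) (simp add: point_of_def plane_of_def)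
qed

end

theory Submission
  imports Defs
begin

text \<open>
  Two kinds of generators of \<open>RL(3,3)\<close> are visible: the exterior squares \<open>\<Lambda>\<^sup>2A\<close>, for which the form
  gets multiplied by \<open>det A\<close>, and the Gram matrix itself, which is the Hodge star and represents the
  standard polarity. They induce the transformation of \<open>A\<close> and the polarity of the unit matrix.

  The null 3-spaces are classified by pure spinors: in the spin representation the elements of a null
  3-space anticommute and square to zero, so the product of three basis elements is a nonzero operator
  whose image is annihilated by the whole space; an annihilated vector or covector is the point or
  the plane sought.

  For \<open>B\<close> in \<open>RL(3,3)\<close>, multiplication by the Gram matrix and by exterior squares achieves that \<open>B\<close>
  preserves the null 3-spaces of the point \<open>e\<^sub>0\<close> and of the plane \<open>e\<^sub>0\<close>. These are dual to each other
  under the form, so \<open>B\<close> is determined by its restriction to the former and its multiplier, and hence is a multiple of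
  an exterior square. Therefore \<open>B\<close> is \<open>\<plusminus>\<Lambda>\<^sup>2A\<close> or the Gram matrix times \<open>\<plusminus>\<Lambda>\<^sup>2A\<close> with \<open>det A = \<plusminus>1\<close>.
  Since \<open>A\<close> is determined up to sign by the transformation or polarity, the fibres are \<open>{B, -B}\<close>.
\<close>

section \<open>Coordinates and the determinant in dimension four\<close>

lemma sum_4_from_0: "sum f (UNIV :: 4 set) = f 0 + f 1 + f 2 + f 3"
  using sum_4[of f] by (simp add: add_ac index4_zero[symmetric] del: index4_zero)

lemma sum_3_plus_3:
  "sum f (UNIV :: (3 + 3) set) =
     f (Inl 1) + f (Inl 2) + f (Inl 3) + f (Inr 1) + f (Inr 2) + f (Inr 3)"
proof -
  have "sum f (UNIV :: (3 + 3) set) = sum f (UNIV <+> UNIV)"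
    by simp
  also have "\<dots> = (\<Sum>i\<in>UNIV. f (Inl i)) + (\<Sum>i\<in>UNIV. f (Inr i))"
    by (subst sum.Plus) (simp_all add: comp_def)
  finally show ?thesis
    by (simp add: sum_3 add_ac)
qed

lemma inner_4: "X \<bullet> Y = X $ 0 * Y $ 0 + X $ 1 * Y $ 1 + X $ 2 * Y $ 2 + X $ 3 * Y $ 3"
  for X Y :: "real^4"
  by (simp add: inner_vec_def sum_4_from_0)

lemma inner_transpose: "(A *v x) \<bullet> y = x \<bullet> (transpose A *v y)" for A :: "real^'n^'m"
  by (metis dot_lmul_matrix vector_transpose_matrix transpose_transpose)

lemma matrix_eq_via_inner:
  fixes A B :: "real^'n^'n"
  assumes "\<And>x y. x \<bullet> (A *v y) = x \<bullet> (B *v y)"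
  shows "A = B"
proof -
  have "A *v y = B *v y" for y
    using assms vector_eq_ldot by blast
  then show ?thesis
    by (simp add: matrix_eq)
qed

text \<open>The Leibniz sum is unfolded by inserting the indices 0, 1, 2 one at a time into the
  permuted set, so that the formula comes out in the numbering of e_0, ..., e_3.\<close>

lemma det_4:
  "det (A::'a::comm_ring_1^4^4) =
      A$0$0 * A$1$1 * A$2$2 * A$3$3 - A$0$0 * A$1$1 * A$2$3 * A$3$2
    - A$0$0 * A$1$2 * A$2$1 * A$3$3 + A$0$0 * A$1$2 * A$2$3 * A$3$1
    + A$0$0 * A$1$3 * A$2$1 * A$3$2 - A$0$0 * A$1$3 * A$2$2 * A$3$1
    - A$0$1 * A$1$0 * A$2$2 * A$3$3 + A$0$1 * A$1$0 * A$2$3 * A$3$2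
    + A$0$1 * A$1$2 * A$2$0 * A$3$3 - A$0$1 * A$1$2 * A$2$3 * A$3$0
    - A$0$1 * A$1$3 * A$2$0 * A$3$2 + A$0$1 * A$1$3 * A$2$2 * A$3$0
    + A$0$2 * A$1$0 * A$2$1 * A$3$3 - A$0$2 * A$1$0 * A$2$3 * A$3$1
    - A$0$2 * A$1$1 * A$2$0 * A$3$3 + A$0$2 * A$1$1 * A$2$3 * A$3$0
    + A$0$2 * A$1$3 * A$2$0 * A$3$1 - A$0$2 * A$1$3 * A$2$1 * A$3$0
    - A$0$3 * A$1$0 * A$2$1 * A$3$2 + A$0$3 * A$1$0 * A$2$2 * A$3$1
    + A$0$3 * A$1$1 * A$2$0 * A$3$2 - A$0$3 * A$1$1 * A$2$2 * A$3$0
    - A$0$3 * A$1$2 * A$2$0 * A$3$1 + A$0$3 * A$1$2 * A$2$1 * A$3$0"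
proof -
  have f0123: "finite {1::4, 2, 3}" "0 \<notin> {1::4, 2, 3}"
    and f123: "finite {2::4, 3}" "1 \<notin> {2::4, 3}"
    and f23: "finite {3::4}" "2 \<notin> {3::4}"
    by auto
  have UNIV: "(UNIV :: 4 set) = {0, 1, 2, 3}"
    using UNIV_4 by auto
  show ?thesis
    unfolding det_def UNIV
    unfolding sum_over_permutations_insert[OF f0123]
    unfolding sum_over_permutations_insert[OF f123]
    unfolding sum_over_permutations_insert[OF f23]
    unfolding permutes_sing
    by (simp add: sign_swap_id permutation_swap_id permutation_compose sign_compose sign_id
        swap_id_eq algebra_simps)
qed


section \<open>The exterior square of a matrix\<close>

lemma Gram_nth [simp]: "(Gram *v u) $ Inl i = u $ Inr i" "(Gram *v u) $ Inr i = u $ Inl i"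
  using exhaust_3[of i] by (auto simp: matrix_vector_mult_def sum_3_plus_3 Gram_def)

lemma Gram_Gram: "Gram ** Gram = mat 1"
  by (simp add: matrix_eq vec_eq_iff all33 flip: matrix_vector_mul_assoc)

lemma Gram_Gram_vec [simp]: "Gram *v (Gram *v u) = u"
  by (simp add: vec_eq_iff all33)

lemma bform_nth:
  "bform u v = u $ Inl 1 * v $ Inr 1 + u $ Inl 2 * v $ Inr 2 + u $ Inl 3 * v $ Inr 3
             + u $ Inr 1 * v $ Inl 1 + u $ Inr 2 * v $ Inl 2 + u $ Inr 3 * v $ Inl 3"
  by (simp add: bform_def inner_vec_def sum_3_plus_3)

lemma bilinear_bform: "bilinear bform"
  unfolding bilinear_def by (auto intro!: linearI simp: bform_nth algebra_simps)

lemma bform_Gram: "bform (Gram *v u) (Gram *v v) = bform u v"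
  by (simp add: bform_nth)

text \<open>Testing against \<open>Gram *v u\<close> turns the form into the positive definite inner
  product of \<open>u\<close> with itself.\<close>

lemma bform_nondegenerate: "(\<And>v. bform u v = 0) \<Longrightarrow> u = 0"
  by (metis Gram_Gram_vec bform_def inner_eq_zero_iff)

lemma wedge_nth:
  "wedge X Y $ Inl 1 = X $ 0 * Y $ 1 - X $ 1 * Y $ 0"
  "wedge X Y $ Inl 2 = X $ 0 * Y $ 2 - X $ 2 * Y $ 0"
  "wedge X Y $ Inl 3 = X $ 0 * Y $ 3 - X $ 3 * Y $ 0"
  "wedge X Y $ Inr 1 = X $ 2 * Y $ 3 - X $ 3 * Y $ 2"
  "wedge X Y $ Inr 2 = X $ 3 * Y $ 1 - X $ 1 * Y $ 3"
  "wedge X Y $ Inr 3 = X $ 1 * Y $ 2 - X $ 2 * Y $ 1"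
  by (simp_all add: wedge_def bivec_nth)

text \<open>The basis bivectors are wedge products, so decomposable bivectors span. This is how all
  identities for exterior squares are reduced to pairs of vectors.\<close>

lemma linear_eq_on_wedge:
  fixes f g :: "bivec \<Rightarrow> 'a::real_vector"
  assumes "linear f" "linear g" "\<And>X Y. f (wedge X Y) = g (wedge X Y)"
  shows "f u = g u"
proof -
  have "f (E i) = g (E i) \<and> f (E' i) = g (E' i)" for i
    using exhaust_3[of i] assms(3) by (metis wedge_axis)
  then show ?thesis
    by (subst (1 2) bivec_expand[of u])
      (simp add: assms(1,2) linear_add linear_scale)
qed

lemma matrix_eq_on_wedge:
  fixes M N :: "real^(3 + 3)^'n"
  assumes "\<And>X Y. M *v wedge X Y = N *v wedge X Y"
  shows "M = N"
  using linear_eq_on_wedge[of "(*v) M" "(*v) N"] assms by (simp add: matrix_eq)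

text \<open>Taken from the universal property instead of a table of 2x2 minors, so that
  functoriality follows from the action on wedge products alone.\<close>

definition ext2 :: "real^4^4 \<Rightarrow> real^(3 + 3)^(3 + 3)" where
  "ext2 A = matrix (THE L. linear L \<and> (\<forall>X Y. wedge (A *v X) (A *v Y) = L (wedge X Y)))"

lemma ext2_wedge: "ext2 A *v wedge X Y = wedge (A *v X) (A *v Y)"
proof -
  let ?P = "\<lambda>L. linear L \<and> (\<forall>X Y. wedge (A *v X) (A *v Y) = L (wedge X Y))"
  have "bilinear (\<lambda>X Y. wedge (A *v X) (A *v Y))"
    using bilinear_wedge unfolding bilinear_def
    by (auto intro: linear_compose[unfolded comp_def, OF matrix_vector_mul_linear])
  then have "\<exists>!L. ?P L"
    by (rule wedge_universal) (rule wedge_self)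
  then have "?P (THE L. ?P L)"
    by (rule theI')
  then obtain L where L: "linear L" "\<And>X Y. L (wedge X Y) = wedge (A *v X) (A *v Y)" "ext2 A = matrix L"
    unfolding ext2_def by metis
  then show ?thesis
    using fun_cong[OF matrix_vector_mul(2)[OF L(1)]] by simp
qed

lemma ext2_mult: "ext2 (A ** C) = ext2 A ** ext2 C"
  by (rule matrix_eq_on_wedge) (simp add: ext2_wedge flip: matrix_vector_mul_assoc)

lemma ext2_mat_1: "ext2 (mat 1) = mat 1"
  by (rule matrix_eq_on_wedge) (simp add: ext2_wedge)

lemma ext2_scaleR: "ext2 (c *\<^sub>R A) = c\<^sup>2 *\<^sub>R ext2 A"
  by (rule matrix_eq_on_wedge)
    (simp add: ext2_wedge bilinear_lmul[OF bilinear_wedge] bilinear_rmul[OF bilinear_wedge]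
      power2_eq_square flip: scaleR_matrix_vector_assoc)

lemma ext2_inverse:
  assumes "invertible A"
  shows "ext2 A ** ext2 (matrix_inv A) = mat 1" "ext2 (matrix_inv A) ** ext2 A = mat 1"
  using matrix_inv_both[OF assms] by (simp_all add: ext2_mat_1 flip: ext2_mult)

lemma invertible_ext2: "invertible A \<Longrightarrow> invertible (ext2 A)"
  using ext2_inverse by (auto simp: invertible_def)

text \<open>Lagrange's identity: the inner product of bivectors is a determinant of inner products.
  It makes exterior squares compatible with transposition.\<close>

lemma inner_wedge: "wedge X Y \<bullet> wedge Z W = (X \<bullet> Z) * (Y \<bullet> W) - (X \<bullet> W) * (Y \<bullet> Z)"
  by (simp add: inner_vec_def sum_3_plus_3 wedge_nth sum_4_from_0 algebra_simps)

lemma transpose_ext2: "transpose (ext2 A) = ext2 (transpose A)"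
proof -
  have 1: "wedge Z W \<bullet> (transpose (ext2 A) *v wedge X Y) = wedge Z W \<bullet> (ext2 (transpose A) *v wedge X Y)"
    for X Y Z W
    by (simp only: inner_transpose[symmetric] ext2_wedge inner_wedge)
  have "v \<bullet> (transpose (ext2 A) *v wedge X Y) = v \<bullet> (ext2 (transpose A) *v wedge X Y)" for v X Y
    by (rule linear_eq_on_wedge) (auto intro!: linearI 1 simp only: inner_add_left inner_scaleR_left real_scaleR_def)
  then show ?thesis
    by (intro matrix_eq_on_wedge) (metis vector_eq_ldot)
qed

text \<open>The form is the product of two bivectors in the one-dimensional fourth exterior power.
  The four vectors are placed as columns so that a matrix acts on them by multiplication from the
  left.\<close>

lemma bform_wedge:
  "bform (wedge X Y) (wedge Z W) =
     det (transpose (\<chi> j. if j = 0 then X else if j = 1 then Y else if j = 2 then Z else W))"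
  unfolding det_transpose by (simp add: bform_nth wedge_nth det_4 algebra_simps)

lemma matrix_mul_columns:
  fixes A :: "'a::comm_semiring_1^'n^'m"
  shows "A ** transpose (\<chi> j. f j) = transpose (\<chi> j. A *v f j)"
  by (simp add: vec_eq_iff matrix_matrix_mult_def transpose_def matrix_vector_mult_def)

text \<open>On wedge products this is multiplicativity of the determinant; it extends by linearity
  first in the second argument, then in the first.\<close>

lemma bform_ext2: "bform (ext2 A *v u) (ext2 A *v v) = det A * bform u v"
proof -
  have 1: "bform (ext2 A *v wedge X Y) (ext2 A *v wedge Z W) = det A * bform (wedge X Y) (wedge Z W)"
    for X Y Z W
    unfolding ext2_wedge bform_wedge det_mul[symmetric] matrix_mul_columns
    by (rule arg_cong[of _ _ "\<lambda>M. det (transpose M)"]) (simp add: vec_eq_iff)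
  have l: "linear (\<lambda>u. bform (ext2 A *v u) w)" "linear (\<lambda>u. bform w (ext2 A *v u))"
    "linear (\<lambda>u. det A * bform u w)" "linear (\<lambda>u. det A * bform w u)" for w
    by (auto intro!: linearI simp: bilinear_ladd[OF bilinear_bform] bilinear_radd[OF bilinear_bform]
        bilinear_lmul[OF bilinear_bform] bilinear_rmul[OF bilinear_bform] algebra_simps
        matrix_vector_right_distrib matrix_vector_mult_scaleR)
  have 2: "bform (ext2 A *v wedge X Y) (ext2 A *v v) = det A * bform (wedge X Y) v" for X Y
    by (rule linear_eq_on_wedge[OF l(2) l(4)]) (rule 1)
  show ?thesis
    by (rule linear_eq_on_wedge[OF l(1) l(3)]) (rule 2)
qed

text \<open>By \<open>bform_ext2\<close>, the adjoint of \<open>ext2 A\<close> for the form is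
  \<open>det A\<close> times its inverse, while the Gram matrix relates this adjoint to the
  transpose. Conjugation by the Hodge star thus exchanges the actions on vectors and covectors up to
  a scalar.\<close>

lemma inverse_ext2_Gram:
  assumes "invertible A"
  shows "Gram ** ext2 A ** Gram = det A *\<^sub>R ext2 (inv_transpose A)"
proof -
  let ?B = "ext2 (matrix_inv A)"
  have AB: "ext2 A *v (?B *v v) = v" for v
    using ext2_inverse[OF assms] by (simp add: matrix_vector_mul_assoc)
  have "bform u (ext2 A *v v) = det A * bform (?B *v u) v" for u v
    using bform_ext2[of A "?B *v u" v] by (simp add: AB)
  then have "u \<bullet> (Gram *v (ext2 A *v v)) = det A * (u \<bullet> (transpose ?B *v (Gram *v v)))" for u v
    by (simp only: bform_def inner_transpose)
  then have "u \<bullet> ((Gram ** ext2 A ** Gram) *v v) = u \<bullet> ((det A *\<^sub>R transpose ?B) *v v)" for u v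
    by (simp flip: matrix_vector_mul_assoc scaleR_matrix_vector_assoc del: transpose_matrix_vector)
  then show ?thesis
    by (intro matrix_eq_via_inner) (simp add: transpose_ext2 inv_transpose_def)
qed


section \<open>Point spaces and plane spaces\<close>

text \<open>This and \<open>plane_space\<close> are \<open>null_space_of\<close> in terms of a
  representative vector instead of a line.\<close>

definition point_space :: "real^4 \<Rightarrow> bivec set" where
  "point_space X = {wedge X Y | Y. True}"

definition plane_space :: "real^4 \<Rightarrow> bivec set" where
  "plane_space P = span {wedge X Y | X Y. P \<bullet> X = 0 \<and> P \<bullet> Y = 0}"

section \<open>Inverse transposes and the action of invertible matrices\<close>

lemma inv_transpose_cancel:
  assumes "invertible A"
  shows "transpose A ** inv_transpose A = mat 1" "inv_transpose A ** transpose A = mat 1"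
  using matrix_inv_both[OF assms] matrix_transpose_mul transpose_mat
  unfolding inv_transpose_def by metis+

lemma invertible_inv_transpose: "invertible A \<Longrightarrow> invertible (inv_transpose A)"
  using inv_transpose_cancel by (auto simp: invertible_def)

lemma inv_transpose_inv_transpose:
  assumes "invertible A"
  shows "inv_transpose (inv_transpose A) = A"
proof -
  have "matrix_inv (inv_transpose A) = transpose A"
    using inv_transpose_cancel[OF assms] by (intro matrix_inv_eqI)
  then show ?thesis
    by (subst inv_transpose_def) simp
qed

lemma inner_inv_transpose:
  assumes "invertible A"
  shows "(inv_transpose A *v P) \<bullet> (A *v X) = P \<bullet> X"
proof -
  have "(inv_transpose A *v P) \<bullet> (A *v X) = X \<bullet> (transpose A *v (inv_transpose A *v P))"
    by (metis inner_commute inner_transpose)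
  then show ?thesis
    by (simp only: matrix_vector_mul_assoc inv_transpose_cancel[OF assms] matrix_vector_mul_lid
        inner_commute)
qed

lemma inv_vec_cancel:
  fixes A :: "real^'n^'n"
  assumes "invertible A"
  shows "A *v (matrix_inv A *v x) = x" "matrix_inv A *v (A *v x) = x"
  by (simp_all add: matrix_vector_mul_assoc matrix_inv_both[OF assms])

lemma invertible_matrix_inv: "invertible A \<Longrightarrow> invertible (matrix_inv A)" for A :: "real^'n^'n"
  using matrix_inv_both by (auto simp: invertible_def)

lemma invertible_vec_eq_0:
  fixes A :: "real^'n^'n"
  assumes "invertible A"
  shows "A *v x = 0 \<longleftrightarrow> x = 0"
  using inv_vec_cancel(2)[OF assms, of x] by auto

lemma inj_invertible: "invertible A \<Longrightarrow> inj ((*v) A)" for A :: "real^'n^'n"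
  by (rule inj_on_inverseI) (rule inv_vec_cancel(2))

text \<open>An orthogonal matrix reaches the normalised vector and is then scaled by the norm. This
  transitivity reduces statements about an arbitrary point or plane to e_0.\<close>

lemma exists_invertible_mapping_axis:
  fixes X :: "real^'n" and k :: 'n
  assumes "X \<noteq> 0"
  obtains A :: "real^'n^'n" where "invertible A" "A *v axis k 1 = X"
proof -
  obtain Q :: "real^'n^'n" where Q: "orthogonal_matrix Q" "Q *v axis k 1 = X /\<^sub>R norm X"
    by (rule orthogonal_matrix_exists_basis[of "X /\<^sub>R norm X" k]) (use assms in auto)
  have "invertible (norm X *\<^sub>R Q)"
    using Q(1) assms
    by (auto simp: invertible_def orthogonal_matrix_def matrix_scalar_ac
        intro!: exI[of _ "inverse (norm X) *\<^sub>R transpose Q"] simp flip: scalar_matrix_assoc)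
  moreover have "(norm X *\<^sub>R Q) *v axis k 1 = X"
    using Q(2) assms by (simp flip: scaleR_matrix_vector_assoc)
  ultimately show thesis
    using that by blast
qed

lemma null_space_of_point_of: "X \<noteq> 0 \<Longrightarrow> null_space_of (point_of X) = point_space X"
  by (simp add: null_space_of_point point_space_def)

lemma null_space_of_plane_of: "null_space_of (plane_of P) = plane_space P"
  by (simp add: null_space_of_plane plane_space_def)

lemma ext2_point_space:
  assumes "invertible A"
  shows "(*v) (ext2 A) ` point_space X = point_space (A *v X)"
proof -
  have "wedge (A *v X) Y \<in> (*v) (ext2 A) ` point_space X" for Y
  proof
    show "wedge (A *v X) Y = ext2 A *v wedge X (matrix_inv A *v Y)"
      by (simp add: ext2_wedge inv_vec_cancel[OF assms])
  qed (auto simp: point_space_def)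
  then show ?thesis
    by (auto simp: point_space_def ext2_wedge)
qed

lemma ext2_plane_space:
  assumes "invertible A"
  shows "(*v) (ext2 A) ` plane_space P = plane_space (inv_transpose A *v P)"
proof -
  let ?G = "\<lambda>P. {wedge X Y | X Y. P \<bullet> X = 0 \<and> P \<bullet> Y = 0}"
  let ?Q = "inv_transpose A *v P"
  have Q: "?Q \<bullet> (A *v X) = P \<bullet> X" for X
    using assms by (rule inner_inv_transpose)
  have "(*v) (ext2 A) ` ?G P = ?G ?Q"
  proof
    show "(*v) (ext2 A) ` ?G P \<subseteq> ?G ?Q"
      using Q by (auto simp: ext2_wedge) (metis Q)
    show "?G ?Q \<subseteq> (*v) (ext2 A) ` ?G P"
    proof
      fix u assume "u \<in> ?G ?Q"
      then obtain X Y where u: "u = wedge X Y" "?Q \<bullet> X = 0" "?Q \<bullet> Y = 0"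
        by blast
      let ?X = "matrix_inv A *v X" and ?Y = "matrix_inv A *v Y"
      have "P \<bullet> ?X = 0" "P \<bullet> ?Y = 0"
        using u(2,3) Q[of ?X] Q[of ?Y] by (simp_all add: inv_vec_cancel[OF assms])
      moreover have "u = ext2 A *v wedge ?X ?Y"
        by (simp add: u(1) ext2_wedge inv_vec_cancel[OF assms])
      ultimately show "u \<in> (*v) (ext2 A) ` ?G P"
        by blast
    qed
  qed
  then show ?thesis
    by (simp only: plane_space_def linear_span_image[OF matrix_vector_mul_linear, symmetric])
qed

section \<open>The null spaces of e_0 and the duality of points and planes\<close>

lemma point_space_axis: "point_space (axis 0 1) = {u. \<forall>i. u $ Inr i = 0}"
proof
  show "point_space (axis 0 1) \<subseteq> {u. \<forall>i. u $ Inr i = 0}"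
    by (auto simp: point_space_def forall_3 wedge_nth axis_nth')
  show "{u. \<forall>i. u $ Inr i = 0} \<subseteq> point_space (axis 0 1)"
  proof
    fix u :: bivec assume "u \<in> {u. \<forall>i. u $ Inr i = 0}"
    then have "u = wedge (axis 0 1) (u $ Inl 1 *\<^sub>R axis 1 1 + u $ Inl 2 *\<^sub>R axis 2 1 + u $ Inl 3 *\<^sub>R axis 3 1)"
      by (simp add: vec_eq_iff all33 wedge_nth axis_nth')
    then show "u \<in> point_space (axis 0 1)"
      unfolding point_space_def by blast
  qed
qed

lemma plane_space_axis: "plane_space (axis 0 1) = {u. \<forall>i. u $ Inl i = 0}"
proof
  have "subspace {u :: bivec. \<forall>i. u $ Inl i = 0}"
    by (auto simp: subspace_def)
  then show "plane_space (axis 0 1) \<subseteq> {u. \<forall>i. u $ Inl i = 0}"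
    unfolding plane_space_def
    by (intro span_minimal) (auto simp: forall_3 wedge_nth inner_axis')
  show "{u. \<forall>i. u $ Inl i = 0} \<subseteq> plane_space (axis 0 1)"
  proof
    fix u :: bivec assume "u \<in> {u. \<forall>i. u $ Inl i = 0}"
    then have u: "u = u $ Inr 1 *\<^sub>R E' 1 + u $ Inr 2 *\<^sub>R E' 2 + u $ Inr 3 *\<^sub>R E' 3"
      by (subst bivec_expand[of u]) simp
    have "wedge (axis i 1) (axis j 1) \<in> plane_space (axis 0 1)" if "i \<noteq> 0" "j \<noteq> 0" for i j :: 4
    proof -
      have "axis 0 1 \<bullet> axis i (1::real) = 0" "axis 0 1 \<bullet> axis j (1::real) = 0"
        using that by (simp_all add: inner_axis_axis)
      then show ?thesis
        unfolding plane_space_def by (intro span_base) blast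
    qed
    from this[of 2 3] this[of 3 1] this[of 1 2]
    have "E' i \<in> plane_space (axis 0 1)" for i
      using exhaust_3[of i] by (auto simp: wedge_axis)
    then show "u \<in> plane_space (axis 0 1)"
      by (subst u) (auto simp: plane_space_def intro!: span_add span_scale)
  qed
qed

lemma Gram_point_space_axis: "(*v) Gram ` point_space (axis 0 1) = plane_space (axis 0 1)"
proof
  show "(*v) Gram ` point_space (axis 0 1) \<subseteq> plane_space (axis 0 1)"
    by (auto simp: point_space_axis plane_space_axis)
  show "plane_space (axis 0 1) \<subseteq> (*v) Gram ` point_space (axis 0 1)"
  proof
    fix u assume "u \<in> plane_space (axis 0 1)"
    then have "Gram *v u \<in> point_space (axis 0 1)"
      by (simp add: point_space_axis plane_space_axis)
    then show "u \<in> (*v) Gram ` point_space (axis 0 1)"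
      by (intro image_eqI[of u _ "Gram *v u"]) simp_all
  qed
qed

lemma invertible_image_eq_iff:
  fixes A :: "real^'n^'n"
  assumes "invertible A"
  shows "(*v) A ` S = (*v) A ` T \<longleftrightarrow> S = T"
  using inj_invertible[OF assms] by (rule inj_image_eq_iff)

lemma scaleR_image_subspace:
  fixes A :: "real^'n^'m"
  assumes "subspace S" "c \<noteq> 0"
  shows "(*v) (c *\<^sub>R A) ` S = (*v) A ` S"
proof -
  have "(c *\<^sub>R A) *v x \<in> (*v) A ` S" "A *v x \<in> (*v) (c *\<^sub>R A) ` S" if "x \<in> S" for x
  proof -
    show "(c *\<^sub>R A) *v x \<in> (*v) A ` S"
      using subspace_scale[OF assms(1) that, of c]
      by (intro image_eqI[of _ _ "c *\<^sub>R x"]) (simp_all add: matrix_vector_mult_scaleR flip: scaleR_matrix_vector_assoc)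
    show "A *v x \<in> (*v) (c *\<^sub>R A) ` S"
      using subspace_scale[OF assms(1) that, of "1 / c"] assms(2)
      by (intro image_eqI[of _ _ "(1 / c) *\<^sub>R x"]) (simp_all add: matrix_vector_mult_scaleR flip: scaleR_matrix_vector_assoc)
  qed
  then show ?thesis
    by blast
qed

lemma subspace_plane_space: "subspace (plane_space P)"
  by (simp add: plane_space_def)

text \<open>At e_0 the Gram matrix just swaps the two coordinate halves. For X = A e_0, conjugation
  by it replaces \<open>ext2 A\<close> by a multiple of the exterior square of the inverse
  transpose, which carries the plane e_0 to the plane A e_0.\<close>

lemma Gram_point_space:
  assumes "X \<noteq> 0"
  shows "(*v) Gram ` point_space X = plane_space X"
proof -
  obtain A :: "real^4^4" where A: "invertible A" "A *v axis 0 1 = X"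
    using exists_invertible_mapping_axis[OF assms, where k = 0] .
  have "det A \<noteq> 0"
    using A(1) by (simp add: invertible_det_nz)
  have "(*v) Gram ` point_space X = (*v) (Gram ** ext2 A ** Gram) ` (*v) Gram ` point_space (axis 0 1)"
    using ext2_point_space[OF A(1), of "axis 0 1"] A(2)
    by (simp add: image_image flip: matrix_vector_mul_assoc) (metis image_image)
  also have "\<dots> = (*v) (ext2 (inv_transpose A)) ` plane_space (axis 0 1)"
    using \<open>det A \<noteq> 0\<close>
    by (simp add: inverse_ext2_Gram[OF A(1)] Gram_point_space_axis scaleR_image_subspace
        subspace_plane_space)
  also have "\<dots> = plane_space X"
    using A by (simp add: ext2_plane_space invertible_inv_transpose inv_transpose_inv_transpose)
  finally show ?thesis .
qed

lemma Gram_plane_space: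
  assumes "P \<noteq> 0"
  shows "(*v) Gram ` plane_space P = point_space P"
  by (simp add: image_image flip: Gram_point_space[OF assms])

lemma subspace_point_space: "subspace (point_space X)"
proof -
  have "point_space X = wedge X ` UNIV"
    by (auto simp: point_space_def)
  then show ?thesis
    using bilinear_wedge linear_subspace_image[of "wedge X" UNIV] by (simp add: bilinear_def)
qed

lemma dim_invertible_image:
  fixes A :: "real^'n^'n"
  assumes "invertible A"
  shows "dim ((*v) A ` S) = dim S"
  using inj_invertible[OF assms] inj_on_subset
  by (intro dim_image_eq) auto

lemma dim_point_space:
  assumes "X \<noteq> 0"
  shows "dim (point_space X) = 3"
proof -
  have inj: "inj E"
    by (auto simp: inj_def E_def axis_eq_axis)
  have "point_space (axis 0 1) = span (range E)"
  proof
    show "point_space (axis 0 1) \<subseteq> span (range E)"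
    proof
      fix u assume "u \<in> point_space (axis 0 1)"
      then have "u = u $ Inl 1 *\<^sub>R E 1 + u $ Inl 2 *\<^sub>R E 2 + u $ Inl 3 *\<^sub>R E 3"
        by (subst bivec_expand[of u]) (simp add: point_space_axis)
      then show "u \<in> span (range E)"
        by (metis rangeI span_add span_base span_scale)
    qed
    show "span (range E) \<subseteq> point_space (axis 0 1)"
      by (rule span_minimal[OF _ subspace_point_space]) (auto simp: point_space_axis bivec_nth)
  qed
  moreover have "independent (range E)"
    by (rule independent_mono[OF independent_Basis]) (auto simp: E_def axis_in_Basis_iff)
  ultimately have "dim (point_space (axis 0 1)) = 3"
    by (simp add: dim_eq_card_independent card_image[OF inj])
  moreover obtain A :: "real^4^4" where A: "invertible A" "A *v axis 0 1 = X"
    using exists_invertible_mapping_axis[OF assms, where k = 0] .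
  ultimately show ?thesis
    using ext2_point_space[OF A(1), of "axis 0 1"]
      dim_invertible_image[OF invertible_ext2[OF A(1)], of "point_space (axis 0 1)"] A(2)
    by simp
qed

lemma point_space_null:
  assumes "X \<noteq> 0"
  shows "point_space X \<in> null_three_spaces"
  using assms
  by (auto simp: null_three_spaces_def subspace_point_space dim_point_space)
    (auto simp: point_space_def bform_nth wedge_nth algebra_simps)

lemma invertible_Gram: "invertible Gram"
  using Gram_Gram by (auto simp: invertible_def)

text \<open>Transported from the point space by \<open>Gram\<close>, an isometry of the
  form.\<close>

lemma plane_space_null:
  assumes "P \<noteq> 0"
  shows "plane_space P \<in> null_three_spaces"
proof -
  have "bform u v = 0" if "u \<in> plane_space P" "v \<in> plane_space P" for u v
    using that point_space_null[OF assms]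
    by (auto simp: null_three_spaces_def bform_Gram simp flip: Gram_point_space[OF assms])
  then show ?thesis
    using dim_invertible_image[OF invertible_Gram, of "point_space P"]
    by (simp add: null_three_spaces_def subspace_plane_space dim_point_space Gram_point_space assms)
qed


section \<open>Classification of the null 3-spaces\<close>

text \<open>
  The pair of maps \<open>contraction (Gram *v u)\<close>,
  \<open>contraction u\<close> between \<open>\<real>\<^sup>4\<close> and its dual is the spin representation of \<open>\<real>\<^sup>3\<^sup>,\<^sup>3\<close>.
\<close>

definition contraction :: "bivec \<Rightarrow> real^4 \<Rightarrow> real^4" where
  "contraction u P = (\<chi> i.
     if i = 0 then u $ Inl 1 * P $ 1 + u $ Inl 2 * P $ 2 + u $ Inl 3 * P $ 3
     else if i = 1 then - u $ Inl 1 * P $ 0 + u $ Inr 3 * P $ 2 - u $ Inr 2 * P $ 3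
     else if i = 2 then - u $ Inl 2 * P $ 0 - u $ Inr 3 * P $ 1 + u $ Inr 1 * P $ 3
     else - u $ Inl 3 * P $ 0 + u $ Inr 2 * P $ 1 - u $ Inr 1 * P $ 2)"

lemma contraction_nth:
  "contraction u P $ 0 = u $ Inl 1 * P $ 1 + u $ Inl 2 * P $ 2 + u $ Inl 3 * P $ 3"
  "contraction u P $ 1 = - u $ Inl 1 * P $ 0 + u $ Inr 3 * P $ 2 - u $ Inr 2 * P $ 3"
  "contraction u P $ 2 = - u $ Inl 2 * P $ 0 - u $ Inr 3 * P $ 1 + u $ Inr 1 * P $ 3"
  "contraction u P $ 3 = - u $ Inl 3 * P $ 0 + u $ Inr 2 * P $ 1 - u $ Inr 1 * P $ 2"
  by (simp_all add: contraction_def)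

lemma bilinear_contraction: "bilinear contraction"
  unfolding bilinear_def
  by (auto intro!: linearI simp: contraction_nth vec_eq_iff all4 algebra_simps)

text \<open>Identifies the coordinate formula as the interior product of a bivector with a
  covector.\<close>

lemma contraction_wedge: "contraction (wedge X Y) P = (Y \<bullet> P) *\<^sub>R X - (X \<bullet> P) *\<^sub>R Y"
  by (simp add: contraction_nth vec_eq_iff all4 wedge_nth inner_4 algebra_simps)

text \<open>Polarisation of the Pfaffian identity: \<open>contraction u\<close> is a skew 4x4 matrix
  whose product with that of the dual bivector is minus its Pfaffian times the identity, and
  \<open>bform u u\<close> is twice the Pfaffian.\<close>

lemma Clifford_relation:
  "contraction (Gram *v u) (contraction v P) + contraction (Gram *v v) (contraction u P)
    = - bform u v *\<^sub>R P"
  by (simp add: contraction_nth vec_eq_iff all4 bform_nth algebra_simps)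

lemma contraction_ext2:
  "contraction (ext2 A *v u) P = A *v contraction u (transpose A *v P)"
proof -
  note lin = bilinear_contraction[unfolded bilinear_def]
  have "linear (\<lambda>u. contraction (ext2 A *v u) P)"
    using linear_compose[OF matrix_vector_mul_linear, of "\<lambda>u. contraction u P" "ext2 A"] lin
    by (simp add: comp_def)
  moreover have "linear (\<lambda>u. A *v contraction u (transpose A *v P))"
    using linear_compose[OF _ matrix_vector_mul_linear, of "\<lambda>u. contraction u (transpose A *v P)" A] lin
    by (simp add: comp_def)
  ultimately show ?thesis
    by (rule linear_eq_on_wedge)
      (simp only: ext2_wedge contraction_wedge inner_transpose matrix_vector_mult_diff_distrib
        matrix_vector_mult_scaleR)
qed

text \<open>For e_0 the contraction reads off the first three coordinates up to sign, so its
  vanishing means lying in the other half. The general case follows by equivariance, with A sending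
  e_0 to P.\<close>

lemma contraction_eq_0_imp_plane_space:
  assumes "P \<noteq> 0" "contraction u P = 0"
  shows "u \<in> plane_space P"
proof -
  obtain A :: "real^4^4" where A: "invertible A" "A *v axis 0 1 = P"
    using exists_invertible_mapping_axis[OF assms(1), where k = 0] .
  define v where "v = ext2 (transpose A) *v u"
  have "contraction v (axis 0 1) = transpose A *v contraction u (A *v axis 0 1)"
    by (simp only: v_def contraction_ext2 transpose_transpose)
  also have "\<dots> = 0"
    by (simp only: A(2) assms(2) matrix_vector_mult_0_right)
  finally have "v \<in> plane_space (axis 0 1)"
    by (simp add: plane_space_axis vec_eq_iff all4 contraction_nth axis_nth' forall_3)
  then have "ext2 (inv_transpose A) *v v \<in> (*v) (ext2 (inv_transpose A)) ` plane_space (axis 0 1)"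
    by blast
  also have "\<dots> = plane_space P"
    using A by (simp add: ext2_plane_space invertible_inv_transpose inv_transpose_inv_transpose)
  also have "ext2 (inv_transpose A) *v v = u"
    unfolding v_def matrix_vector_mul_assoc ext2_mult[symmetric] inv_transpose_cancel[OF A(1)]
    by (simp add: ext2_mat_1)
  finally show ?thesis .
qed

lemma plane_space_imp_contraction_eq_0:
  assumes "u \<in> plane_space P"
  shows "contraction u P = 0"
  using assms unfolding plane_space_def
proof (rule span_induct)
  show "subspace {u. contraction u P = 0}"
    using bilinear_contraction linear_subspace_kernel[of "\<lambda>u. contraction u P"]
    by (simp add: bilinear_def)
qed (auto simp: contraction_wedge inner_commute)

lemma exists_functional:
  fixes f :: "'a::euclidean_space \<Rightarrow> real"
  assumes "independent S"
  obtains w where "\<And>x. x \<in> S \<Longrightarrow> w \<bullet> x = f x"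
proof -
  obtain g where g: "linear g" "\<And>x. x \<in> S \<Longrightarrow> g x = f x"
    using linear_independent_extend[OF assms] by blast
  have "adjoint g 1 \<bullet> x = g x" for x
    using adjoint_works[OF g(1), of x 1] by (simp add: inner_commute)
  then show thesis
    using that g(2) by metis
qed

text \<open>Suppose that no nonzero vector or covector is annihilated by \<open>N\<close>. For a
  basis a, b, c of \<open>N\<close>, the alternating products of three, two and one factors are
  shown to vanish in turn, and finally the empty product, which is the identity.\<close>

lemma null_three_space_spinor:
  assumes "N \<in> null_three_spaces"
  shows "\<exists>X. X \<noteq> 0 \<and> ((\<forall>u\<in>N. contraction (Gram *v u) X = 0) \<or> (\<forall>u\<in>N. contraction u X = 0))"
proof (rule ccontr)
  assume none: "\<not> ?thesis"
  have null: "bform u v = 0" if "u \<in> N" "v \<in> N" for u v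
    using assms that by (auto simp: null_three_spaces_def)
  obtain S where S: "S \<subseteq> N" "independent S" "N \<subseteq> span S" "card S = 3"
    using basis_exists[of N] assms unfolding null_three_spaces_def by auto
  then obtain a b c where abc: "S = {a, b, c}" "a \<noteq> b" "b \<noteq> c" "a \<noteq> c"
    using card_3_iff by (metis)
  \<comment> \<open>The flag \<open>s\<close> selects one of the two half-spin maps. Composites have
    to alternate between them, and negating the flag treats both cases at once.\<close>
  define \<gamma> where "\<gamma> s u = contraction (if s then Gram *v u else u)" for s u
  have rel: "\<gamma> s u (\<gamma> (\<not> s) v X) + \<gamma> s v (\<gamma> (\<not> s) u X) = - bform u v *\<^sub>R X" for s u v X
    using Clifford_relation[of u v X] Clifford_relation[of "Gram *v u" "Gram *v v" X]
    by (simp add: \<gamma>_def bform_Gram)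
  have lin: "linear (\<gamma> s u)" "linear (\<lambda>u. \<gamma> s u X)" for s u X
    using bilinear_contraction linear_compose[OF matrix_vector_mul_linear[of Gram], of "\<lambda>u. contraction u X"]
    by (cases s; simp add: \<gamma>_def bilinear_def comp_def)+
  note \<gamma>0 [simp] = linear_0[OF lin(1)]
  have anti: "\<gamma> s u (\<gamma> (\<not> s) v X) = - \<gamma> s v (\<gamma> (\<not> s) u X)" if "bform u v = 0" for s u v X
    using rel[of s u v X] that by (simp add: eq_neg_iff_add_eq_0)
  have sq: "\<gamma> s u (\<gamma> (\<not> s) u X) = 0" if "u \<in> N" for s u X
    using rel[of s u u X] null[OF that that] by (simp flip: scaleR_2)
  have neg: "\<gamma> s u (- X) = - \<gamma> s u X" for s u X
    by (rule linear_neg[OF lin(1)])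
  have no_spinor: "X = 0" if "\<And>u. u \<in> S \<Longrightarrow> \<gamma> s u X = 0" for s X
  proof -
    have "\<gamma> s u X = 0" if "u \<in> N" for u
      using linear_eq_0_on_span[OF lin(2)[of s X]] \<open>\<And>u. u \<in> S \<Longrightarrow> \<gamma> s u X = 0\<close> that S(3) by blast
    then show ?thesis
      using none by (cases s) (auto simp: \<gamma>_def)
  qed
  have abcN: "a \<in> N" "b \<in> N" "c \<in> N"
    using S(1) abc(1) by auto
  note anti_ab = anti[OF null[OF abcN(1,2)]]
    and anti_bc = anti[OF null[OF abcN(2,3)]]
    and anti_ac = anti[OF null[OF abcN(1,3)]]
  \<comment> \<open>This product is itself annihilated by \<open>a\<close>, \<open>b\<close> and \<open>c\<close>, so it vanishes by \<open>no_spinor\<close>.\<close>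
  have 3: "\<gamma> s a (\<gamma> (\<not> s) b (\<gamma> s c X)) = 0" for s X
  proof (rule no_spinor[of "\<not> s"])
    fix u assume "u \<in> S"
    then consider "u = a" | "u = b" | "u = c"
      using abc(1) by blast
    then show "\<gamma> (\<not> s) u (\<gamma> s a (\<gamma> (\<not> s) b (\<gamma> s c X))) = 0"
    proof cases
      case 1
      then show ?thesis using sq[OF abcN(1), of "\<not> s"] by simp
    next
      case 2
      then show ?thesis
        using anti_ab[of "\<not> s" "\<gamma> (\<not> s) b (\<gamma> s c X)"] sq[OF abcN(2), of s] by simp
    next
      case 3
      then show ?thesis
        using anti_ac[of "\<not> s" "\<gamma> (\<not> s) b (\<gamma> s c X)"] anti_bc[of s X]
          anti_bc[of s "\<gamma> s c X"] sq[OF abcN(3), of "\<not> s" X] by (simp add: neg)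
    qed
  qed
  have dual: "\<exists>v. \<forall>u\<in>S. bform u v = f u" for f
  proof -
    obtain w where w: "\<And>x. x \<in> S \<Longrightarrow> w \<bullet> x = f x"
      using exists_functional[OF S(2)] by blast
    have "bform u (Gram *v w) = f u" if "u \<in> S" for u
      using w[OF that] by (simp add: bform_def inner_commute)
    then show ?thesis by blast
  qed
  \<comment> \<open>With \<open>v\<close> orthogonal to \<open>a\<close> and \<open>b\<close> and
    pairing to -1 with \<open>c\<close>, the Clifford relation writes the identity as cv + vc. The
    first term extends ab to abc; in the second, \<open>v\<close> moves to the front past b and a,
    which leaves abc again. The next claim repeats this with b in place of c.\<close>
  have 2: "\<gamma> s a (\<gamma> (\<not> s) b X) = 0" for s X
  proof -
    obtain v where v: "bform a v = 0" "bform b v = 0" "bform c v = -1"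
      using dual[of "\<lambda>u. if u = c then -1 else 0"] abc by auto
    have "X = \<gamma> s c (\<gamma> (\<not> s) v X) + \<gamma> s v (\<gamma> (\<not> s) c X)"
      using rel[of s c v X] v(3) by simp
    then have "\<gamma> s a (\<gamma> (\<not> s) b X) =
        \<gamma> s a (\<gamma> (\<not> s) b (\<gamma> s c (\<gamma> (\<not> s) v X))) + \<gamma> s a (\<gamma> (\<not> s) b (\<gamma> s v (\<gamma> (\<not> s) c X)))"
      using linear_add[OF lin(1)] by metis
    also have "\<gamma> s a (\<gamma> (\<not> s) b (\<gamma> s v (\<gamma> (\<not> s) c X))) = \<gamma> s v (\<gamma> (\<not> s) a (\<gamma> s b (\<gamma> (\<not> s) c X)))"
      using anti[OF v(1), of s "\<gamma> s b (\<gamma> (\<not> s) c X)"] anti[OF v(2), of "\<not> s" "\<gamma> (\<not> s) c X"]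
      by (simp add: neg)
    finally show ?thesis
      using 3[of s] 3[of "\<not> s"] by simp
  qed
  have 1: "\<gamma> s a X = 0" for s X
  proof -
    obtain v where v: "bform a v = 0" "bform b v = -1"
      using dual[of "\<lambda>u. if u = b then -1 else 0"] abc by auto
    have "X = \<gamma> (\<not> s) b (\<gamma> s v X) + \<gamma> (\<not> s) v (\<gamma> s b X)"
      using rel[of "\<not> s" b v X] v(2) by simp
    then have "\<gamma> s a X = \<gamma> s a (\<gamma> (\<not> s) b (\<gamma> s v X)) + \<gamma> s a (\<gamma> (\<not> s) v (\<gamma> s b X))"
      using linear_add[OF lin(1)] by metis
    also have "\<gamma> s a (\<gamma> (\<not> s) v (\<gamma> s b X)) = - \<gamma> s v (\<gamma> (\<not> s) a (\<gamma> s b X))"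
      using anti[OF v(1)] .
    finally show ?thesis
      using 2[of s] 2[of "\<not> s"] by simp
  qed
  obtain v where v: "bform a v = -1"
    using dual[of "\<lambda>u. -1"] abc by auto
  \<comment> \<open>Both products on the left of the Clifford relation contain \<open>a\<close> and
    vanish, while its right side is e_0.\<close>
  have "axis 0 1 = (0 :: real^4)"
    using rel[of True a v "axis 0 1"] v 1 by simp
  then show False
    by (simp add: axis_eq_0_iff)
qed

text \<open>The bivectors annihilating the spinor lie in a null 3-space of a point or plane. This
  contains \<open>N\<close> and has the same dimension, so the two agree.\<close>

lemma null_three_space_cases:
  assumes "N \<in> null_three_spaces"
  obtains X where "X \<noteq> 0" "N = point_space X" | P where "P \<noteq> 0" "N = plane_space P"
proof -
  have N: "subspace N" "dim N = 3"
    using assms by (auto simp: null_three_spaces_def)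
  have eq: "N = M" if "N \<subseteq> M" "M \<in> null_three_spaces" for M
    using subspace_dim_equal[of N M] N that by (auto simp: null_three_spaces_def)
  obtain X where X: "X \<noteq> 0"
    "(\<forall>u\<in>N. contraction (Gram *v u) X = 0) \<or> (\<forall>u\<in>N. contraction u X = 0)"
    using null_three_space_spinor[OF assms] by blast
  from X(2) show thesis
  proof
    assume "\<forall>u\<in>N. contraction (Gram *v u) X = 0"
    then have "Gram *v u \<in> plane_space X" if "u \<in> N" for u
      using contraction_eq_0_imp_plane_space[OF X(1)] that by blast
    then have "u \<in> (*v) Gram ` plane_space X" if "u \<in> N" for u
      using that by (intro image_eqI[of u _ "Gram *v u"]) simp_all
    then show thesis
      using that(1) X(1) eq[OF _ point_space_null[OF X(1)]] Gram_plane_space[OF X(1)] by blast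
  next
    assume "\<forall>u\<in>N. contraction u X = 0"
    then show thesis
      using that(2) X(1) eq[OF _ plane_space_null[OF X(1)]] contraction_eq_0_imp_plane_space[OF X(1)]
      by blast
  qed
qed

text \<open>If they agreed, P would annihilate every wedge product with X. The choice Y = P shows
  that P does not vanish on X, so every Y would be a multiple of X.\<close>

lemma point_space_neq_plane_space:
  assumes "X \<noteq> 0" "P \<noteq> 0"
  shows "point_space X \<noteq> plane_space P"
proof
  assume eq: "point_space X = plane_space P"
  have "wedge X Y \<in> plane_space P" for Y
    using eq by (auto simp: point_space_def)
  then have *: "(Y \<bullet> P) *\<^sub>R X = (X \<bullet> P) *\<^sub>R Y" for Y
    using plane_space_imp_contraction_eq_0[of "wedge X Y" P] by (simp add: contraction_wedge)
  have "(P \<bullet> P) *\<^sub>R X = (X \<bullet> P) *\<^sub>R P"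
    using * .
  then have "X \<bullet> P \<noteq> 0"
    using assms by auto
  then have "Y \<in> span {X}" for Y
    using *[of Y] by (metis (no_types) eq_vector_fraction_iff span_base span_scale singletonI divide_inverse_commute scaleR_scaleR)
  then have "dim (UNIV :: (real^4) set) \<le> 1"
    by (metis dim_le_card dim_span is_singletonI is_singleton_altdef finite.emptyI finite.insertI subsetI)
  then show False by simp
qed

text \<open>After moving X to e_0, the other vector Z has all products with e_1 and e_2 in the first
  coordinate half, which kills its coordinates 1, 2 and 3.\<close>

lemma point_space_eq_imp:
  assumes "X \<noteq> 0" "point_space X = point_space Y" "Y \<noteq> 0"
  shows "span {X} = span {Y}"
proof -
  obtain A :: "real^4^4" where A: "invertible A" "A *v axis 0 1 = X"
    using exists_invertible_mapping_axis[OF assms(1), where k = 0] .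
  define Z where "Z = matrix_inv A *v Y"
  have Z: "A *v Z = Y"
    by (simp add: Z_def inv_vec_cancel[OF A(1)])
  have "(*v) (ext2 A) ` point_space (axis 0 1) = (*v) (ext2 A) ` point_space Z"
    using assms(2) by (simp add: ext2_point_space[OF A(1)] A(2) Z)
  then have "point_space (axis 0 1) = point_space Z"
    by (simp add: invertible_image_eq_iff invertible_ext2[OF A(1)])
  then have "wedge Z W \<in> point_space (axis 0 1)" for W
    by (auto simp: point_space_def)
  then have "wedge Z W $ Inr i = 0" for W i
    by (simp add: point_space_axis)
  from this[of "axis 1 1" 2] this[of "axis 1 1" 3] this[of "axis 2 1" 3]
  have "Z $ 3 = 0" "Z $ 2 = 0" "Z $ 1 = 0"
    by (simp_all add: wedge_nth axis_nth')
  then have "Z = Z $ 0 *\<^sub>R axis 0 1"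
    by (simp add: vec_eq_iff all4 axis_nth')
  then have "Y = Z $ 0 *\<^sub>R X"
    using Z A(2) by (metis matrix_vector_mult_scaleR)
  then show ?thesis
    using assms(3) span_scaleR_singleton[of "Z $ 0" X] by auto
qed

lemma null_space_of_cases:
  assumes "x \<in> proj_elements"
  obtains X where "X \<noteq> 0" "x = point_of X" "null_space_of x = point_space X"
  | P where "P \<noteq> 0" "x = plane_of P" "null_space_of x = plane_space P"
  using assms null_space_of_point_of null_space_of_plane_of by (auto simp: proj_elements_def)

lemma bij_betw_null_space_of: "bij_betw null_space_of proj_elements null_three_spaces"
proof (rule bij_betw_imageI)
  show "inj_on null_space_of proj_elements"
  proof (rule inj_onI)
    fix x y assume xy: "x \<in> proj_elements" "y \<in> proj_elements" "null_space_of x = null_space_of y"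
    show "x = y"
      using xy(1)
    proof (cases rule: null_space_of_cases)
      case X: (1 X)
      show ?thesis
        using xy(2)
      proof (cases rule: null_space_of_cases)
        case Y: (1 Y)
        then show ?thesis
          using X xy(3) point_space_eq_imp[of X Y] by (simp add: point_of_def)
      next
        case Y: (2 Y)
        then show ?thesis
          using X xy(3) point_space_neq_plane_space[of X Y] by simp
      qed
    next
      case X: (2 X)
      show ?thesis
        using xy(2)
      proof (cases rule: null_space_of_cases)
        case Y: (1 Y)
        then show ?thesis
          using X xy(3) point_space_neq_plane_space[of Y X] by simp
      next
        case Y: (2 Y)
        then have "plane_space X = plane_space Y"
          using X xy(3) by simp
        \<comment> \<open>Applying the Gram matrix reduces planes to points.\<close>
        then have "point_space X = point_space Y"
          using X(1) Y(1) by (simp flip: Gram_plane_space)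
        then show ?thesis
          using X Y point_space_eq_imp[of X Y] by (simp add: plane_of_def)
      qed
    qed
  qed
  show "null_space_of ` proj_elements = null_three_spaces"
  proof
    show "null_space_of ` proj_elements \<subseteq> null_three_spaces"
      by (auto elim!: null_space_of_cases simp: point_space_null plane_space_null)
    show "null_three_spaces \<subseteq> null_space_of ` proj_elements"
    proof
      fix N assume "N \<in> null_three_spaces"
      then show "N \<in> null_space_of ` proj_elements"
      proof (cases rule: null_three_space_cases)
        case (1 X)
        then show ?thesis
          by (intro image_eqI[of _ _ "point_of X"]) (auto simp: null_space_of_point_of proj_elements_def)
      next
        case (2 P)
        then show ?thesis
          by (intro image_eqI[of _ _ "plane_of P"]) (auto simp: null_space_of_plane_of proj_elements_def)
      qed
    qed
  qed
qed


section \<open>The structure of \<open>RL(3,3)\<close>\<close>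

text \<open>The multiplier may be any nonzero real, since normalising \<open>B\<close> uses exterior
  squares of matrices of arbitrary nonzero determinant.\<close>

definition similitude :: "real \<Rightarrow> real^(3 + 3)^(3 + 3) \<Rightarrow> bool" where
  "similitude e B \<longleftrightarrow> invertible B \<and> e \<noteq> 0 \<and> (\<forall>u v. bform (B *v u) (B *v v) = e * bform u v)"

lemma similitude_ext2: "invertible A \<Longrightarrow> similitude (det A) (ext2 A)"
  by (auto simp: similitude_def invertible_ext2 bform_ext2 invertible_det_nz[symmetric])

lemma similitude_Gram: "similitude 1 Gram"
  by (simp add: similitude_def invertible_Gram bform_Gram)

lemma similitude_mult: "similitude e B \<Longrightarrow> similitude f C \<Longrightarrow> similitude (e * f) (B ** C)"
  by (simp add: similitude_def invertible_mult flip: matrix_vector_mul_assoc)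

lemma similitude_null_three_spaces:
  assumes "similitude e B" "N \<in> null_three_spaces"
  shows "(*v) B ` N \<in> null_three_spaces"
  using assms dim_invertible_image[of B N] linear_subspace_image[OF matrix_vector_mul_linear, of N B]
  by (auto simp: similitude_def null_three_spaces_def)

lemma bform_transpose: "bform (B *v u) (B *v v) = u \<bullet> ((transpose B ** Gram ** B) *v v)"
  by (simp only: bform_def inner_transpose matrix_vector_mul_assoc matrix_mul_assoc)

lemma uminus_matrix_vector: "(- B) *v v = - (B *v v)" for B :: "real^'n^'m"
  using scaleR_matrix_vector_assoc[of "-1" B v] by simp

lemma RL33_iff: "B \<in> carrier RL33 \<longleftrightarrow> similitude 1 B \<or> similitude (-1) B"
proof -
  have "transpose B ** Gram ** B = M \<longleftrightarrow> (\<forall>u v. bform (B *v u) (B *v v) = u \<bullet> (M *v v))" for M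
    unfolding bform_transpose using matrix_eq_via_inner by blast
  from this[of Gram] this[of "- Gram"] show ?thesis
    by (auto simp: RL33_def similitude_def uminus_matrix_vector bform_def)
qed

section \<open>Similitudes as multiples of exterior squares\<close>

lemma decompose_axis_spaces:
  obtains v w where "v \<in> point_space (axis 0 1)" "w \<in> plane_space (axis 0 1)" "u = v + w"
proof
  let ?v = "u $ Inl 1 *\<^sub>R E 1 + u $ Inl 2 *\<^sub>R E 2 + u $ Inl 3 *\<^sub>R E 3"
  show "?v \<in> point_space (axis 0 1)"
    by (simp add: point_space_axis bivec_nth)
  show "u - ?v \<in> plane_space (axis 0 1)"
    by (simp add: plane_space_axis bivec_nth forall_3)
qed simp

text \<open>The point space of e_0 is a copy of R^4 modulo e_0, so \<open>B\<close> induces a map of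
  that quotient; it is lifted to R^4 with a free eigenvalue on e_0. Duality under the form then
  controls the plane space.\<close>

lemma similitude_fixing_axis_spaces:
  assumes "similitude e B"
    and pt: "(*v) B ` point_space (axis 0 1) \<subseteq> point_space (axis 0 1)"
    and pl: "(*v) B ` plane_space (axis 0 1) \<subseteq> plane_space (axis 0 1)"
  obtains A c where "invertible A" "c \<noteq> 0" "B = c *\<^sub>R ext2 A"
proof -
  let ?e0 = "axis 0 1 :: real^4"
  have B: "invertible B" "e \<noteq> 0" "\<And>u v. bform (B *v u) (B *v v) = e * bform u v"
    using assms(1) by (auto simp: similitude_def)
  \<comment> \<open>On the point space of e_0, \<open>p\<close> is a right inverse of the wedge
    product with e_0, with values in the span of e_1, e_2, e_3.\<close>
  define p :: "bivec \<Rightarrow> real^4" where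
    "p u = u $ Inl 1 *\<^sub>R axis 1 1 + u $ Inl 2 *\<^sub>R axis 2 1 + u $ Inl 3 *\<^sub>R axis 3 1" for u
  have p: "linear p"
    by (rule linearI) (simp_all add: p_def algebra_simps)
  \<comment> \<open>\<open>ext2 (M a)\<close> is \<open>a B\<close> on the point space and a multiple \<open>d B\<close> on the plane space, with \<open>d\<close>
    independent of \<open>a\<close>; so \<open>a = d\<close> is the right choice.\<close>
  define M where "M a = matrix (\<lambda>X. (a * X $ 0) *\<^sub>R ?e0 + p (B *v wedge ?e0 X))" for a
  have M: "M a *v X = (a * X $ 0) *\<^sub>R ?e0 + p (B *v wedge ?e0 X)" for a X
  proof -
    have "linear (\<lambda>X. B *v wedge ?e0 X)"
      using bilinear_wedge linear_compose[OF _ matrix_vector_mul_linear[of B], of "wedge ?e0"]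
      by (simp add: bilinear_def comp_def)
    then have "linear (\<lambda>X. p (B *v wedge ?e0 X))"
      using linear_compose[OF _ p] by (auto simp: comp_def)
    moreover have "linear (\<lambda>X :: real^4. (a * X $ 0) *\<^sub>R ?e0)"
      by (rule linearI) (simp_all add: algebra_simps)
    ultimately have "linear (\<lambda>X. (a * X $ 0) *\<^sub>R ?e0 + p (B *v wedge ?e0 X))"
      by (intro linear_compose_add)
    then show ?thesis
      unfolding M_def by (rule fun_cong[OF matrix_vector_mul(2)])
  qed
  have M_e0: "M a *v ?e0 = a *\<^sub>R ?e0" for a
    by (simp add: M wedge_self linear_0[OF p] axis_nth')
  have wedge_M: "wedge ?e0 (M a *v X) = B *v wedge ?e0 X" for a X
  proof -
    have "wedge ?e0 X \<in> point_space ?e0"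
      by (auto simp: point_space_def)
    then have "B *v wedge ?e0 X \<in> point_space ?e0"
      using pt by blast
    then show ?thesis
      by (simp add: point_space_axis vec_eq_iff all33 wedge_nth axis_nth' M p_def)
  qed
  have M_nth_0: "(M a *v X) $ 0 = a * X $ 0" for a X
    by (simp add: M p_def axis_nth')
  have inv_M: "invertible (M a)" if "a \<noteq> 0" for a
  proof -
    have "X = 0" if "M a *v X = 0" for X
    proof -
      have "B *v wedge ?e0 X = 0"
        using wedge_M[of a X] that by (simp add: bilinear_rzero[OF bilinear_wedge])
      then have "wedge ?e0 X = 0"
        by (simp add: invertible_vec_eq_0[OF B(1)])
      then show "X = 0"
        using M_nth_0[of a X] that \<open>a \<noteq> 0\<close>
        by (simp add: vec_eq_iff all4 all33 wedge_nth axis_nth')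
    qed
    then show ?thesis
      by (simp add: invertible_left_inverse matrix_left_invertible_ker)
  qed
  have on_point: "ext2 (M a) *v u = a *\<^sub>R (B *v u)" if "u \<in> point_space ?e0" for a u
    using that
    by (auto simp: point_space_def ext2_wedge M_e0 bilinear_lmul[OF bilinear_wedge] wedge_M)
  \<comment> \<open>The quotient of the multipliers of \<open>ext2 (M 1)\<close> and
    \<open>B\<close>.\<close>
  define d where "d = det (M 1) / e"
  have "d \<noteq> 0"
    using inv_M[of 1] B(2) by (simp add: d_def invertible_det_nz)
  \<comment> \<open>\<open>M a\<close> only scales the coordinate 0, so it preserves the hyperplane
    where this coordinate vanishes.\<close>
  have invariant: "ext2 (M a) *v w \<in> plane_space ?e0" if "w \<in> plane_space ?e0" "a \<noteq> 0" for a w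
  proof -
    have "(inv_transpose (M a) *v ?e0) \<bullet> Z = (inverse a *\<^sub>R ?e0) \<bullet> Z" for Z
      using inner_inv_transpose[OF inv_M[OF that(2)], of ?e0 "matrix_inv (M a) *v Z"]
        M_nth_0[of a "matrix_inv (M a) *v Z"] that(2)
      by (simp add: inv_vec_cancel[OF inv_M[OF that(2)]] inner_axis')
    then have "inv_transpose (M a) *v ?e0 = inverse a *\<^sub>R ?e0"
      using vector_eq_rdot by blast
    moreover have "plane_space (inverse a *\<^sub>R ?e0) = plane_space ?e0"
      using that(2) null_space_of_plane_of plane_of_scaleR by (metis inverse_nonzero_iff_nonzero)
    ultimately have "(*v) (ext2 (M a)) ` plane_space ?e0 = plane_space ?e0"
      by (simp only: ext2_plane_space[OF inv_M[OF that(2)]])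
    then show ?thesis
      using that(1) by blast
  qed
  have on_plane_1: "ext2 (M 1) *v w = d *\<^sub>R (B *v w)" if w: "w \<in> plane_space ?e0" for w
  proof -
    \<comment> \<open>The difference lies in a null space, so it is orthogonal to the plane space.
      It is also orthogonal to the image of the point space, where \<open>ext2 (M 1)\<close> and
      \<open>B\<close> agree and the choice of \<open>d\<close> cancels the multipliers.\<close>
    let ?z = "ext2 (M 1) *v w - d *\<^sub>R (B *v w)"
    have z: "?z \<in> plane_space ?e0"
      using invariant[OF w, of 1] pl w
      by (intro subspace_diff subspace_scale subspace_plane_space) auto
    have plane_null: "bform x y = 0" if "x \<in> plane_space ?e0" "y \<in> plane_space ?e0" for x y
      using plane_space_null[of ?e0] that by (auto simp: null_three_spaces_def axis_eq_0_iff)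
    have "bform ?z (B *v u) = 0" for u
    proof -
      obtain x y where u: "x \<in> point_space ?e0" "y \<in> plane_space ?e0" "u = x + y"
        by (rule decompose_axis_spaces)
      have "bform ?z (B *v u) = bform ?z (B *v x) + bform ?z (B *v y)"
        by (simp add: u(3) matrix_vector_right_distrib bilinear_radd[OF bilinear_bform])
      also have "bform ?z (B *v y) = 0"
        using plane_null[OF z] pl u(2) by blast
      also have "bform ?z (B *v x) = bform (ext2 (M 1) *v w) (ext2 (M 1) *v x) - d * bform (B *v w) (B *v x)"
        by (simp add: bilinear_lsub[OF bilinear_bform] bilinear_lmul[OF bilinear_bform]
            on_point[OF u(1)])
      also have "\<dots> = 0"
        using B(2) by (simp add: bform_ext2 B(3) d_def)
      finally show ?thesis by simp
    qed
    then have "bform ?z v = 0" for v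
      by (metis inv_vec_cancel(1)[OF B(1)])
    then have "?z = 0"
      by (rule bform_nondegenerate)
    then show ?thesis by simp
  qed
  have on_plane: "ext2 (M a) *v w = d *\<^sub>R (B *v w)" if "w \<in> plane_space ?e0" for a w
  proof -
    \<comment> \<open>The parameter enters \<open>M a\<close> only through the coordinate 0, which
      vanishes on the vectors whose products span the plane space.\<close>
    have "ext2 (M a) *v w = ext2 (M 1) *v w"
      using that unfolding plane_space_def
    proof (rule span_induct)
      show "subspace {u. ext2 (M a) *v u = ext2 (M 1) *v u}"
        by (auto simp: subspace_def matrix_vector_right_distrib matrix_vector_mult_scaleR)
    qed (auto simp: ext2_wedge M inner_axis')
    then show ?thesis
      by (simp add: on_plane_1[OF that])
  qed
  have "ext2 (M d) *v u = d *\<^sub>R (B *v u)" for u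
  proof -
    obtain x y where u: "x \<in> point_space ?e0" "y \<in> plane_space ?e0" "u = x + y"
      by (rule decompose_axis_spaces)
    then show ?thesis
      by (simp add: on_point on_plane matrix_vector_right_distrib scaleR_add_right)
  qed
  then have "B = inverse d *\<^sub>R ext2 (M d)"
    using \<open>d \<noteq> 0\<close> by (simp add: matrix_eq flip: scaleR_matrix_vector_assoc)
  then show thesis
    using that inv_M[OF \<open>d \<noteq> 0\<close>] \<open>d \<noteq> 0\<close> by (metis nonzero_imp_inverse_nonzero)
qed

text \<open>Two points lie on a common line, so two point spaces always meet nontrivially. A plane
  through e_0 contains lines through e_0, so the plane must miss e_0.\<close>

lemma null_complement_of_axis_point_space:
  assumes "N \<in> null_three_spaces" "N \<inter> point_space (axis 0 1) \<subseteq> {0}"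
  obtains P where "N = plane_space P" "P $ 0 \<noteq> 0"
  using assms(1)
proof (cases rule: null_three_space_cases)
  case (1 Y)
  have zero: "wedge Y W = 0" if "\<forall>i. wedge Y W $ Inr i = 0" for W
    using that assms(2) 1(2) by (auto simp: point_space_axis) (auto simp: point_space_def)
  have "wedge Y (axis 0 1) = 0"
    by (rule zero) (simp add: forall_3 wedge_nth axis_nth')
  then have Y: "Y $ 1 = 0" "Y $ 2 = 0" "Y $ 3 = 0"
    by (simp_all add: vec_eq_iff all33 wedge_nth axis_nth')
  then have "wedge Y (axis 1 1) = 0"
    by (intro zero) (simp add: forall_3 wedge_nth axis_nth')
  then have "Y = 0"
    using Y by (simp add: vec_eq_iff all33 all4 wedge_nth axis_nth')
  then show thesis
    using 1(1) by simp
next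
  case (2 P)
  have "P $ 0 \<noteq> 0"
  proof
    assume P0: "P $ 0 = 0"
    have zero: "wedge (axis 0 1) W = 0" if "P \<bullet> W = 0" for W
    proof -
      have "P \<bullet> axis 0 1 = 0"
        using P0 by (simp add: inner_axis)
      then have "wedge (axis 0 1) W \<in> N"
        unfolding 2(2) plane_space_def using that by (intro span_base) blast
      moreover have "wedge (axis 0 1) W \<in> point_space (axis 0 1)"
        by (auto simp: point_space_def)
      ultimately show ?thesis
        using assms(2) by blast
    qed
    \<comment> \<open>Two vectors in the kernel of P without e_0 component; if their products with
      e_0 vanish, they are zero themselves, and so are the coordinates 1, 2, 3 of P.\<close>
    have "wedge (axis 0 1) (P $ 2 *\<^sub>R axis 1 1 - P $ 1 *\<^sub>R axis 2 1) = 0"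
      "wedge (axis 0 1) (P $ 3 *\<^sub>R axis 2 1 - P $ 2 *\<^sub>R axis 3 1) = 0"
      by (auto intro!: zero simp: inner_4 axis_nth')
    then have "P = 0"
      using P0 by (simp add: vec_eq_iff all33 all4 wedge_nth axis_nth')
    then show False
      using 2(1) by simp
  qed
  then show thesis
    using that 2(2) by blast
qed

text \<open>A shear along e_0: it replaces the coordinate 0 of X by the value of P on X, normalised
  to fix e_0. The kernel of P thus goes to the hyperplane of vanishing coordinate 0.\<close>

lemma exists_map_to_axis_plane:
  fixes P :: "real^4"
  assumes "P $ 0 \<noteq> 0"
  obtains A where "invertible A" "A *v axis 0 1 = axis 0 1"
    "(*v) (ext2 A) ` plane_space P \<subseteq> plane_space (axis 0 1)"
proof -
  define f where "f X = X + ((P \<bullet> X) / P $ 0 - X $ 0) *\<^sub>R (axis 0 1 :: real^4)" for X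
  have "linear f"
    by (rule linearI) (simp_all add: f_def inner_add_right add_divide_distrib algebra_simps)
  define A where "A = matrix f"
  have A: "A *v X = f X" for X
    unfolding A_def by (rule fun_cong[OF matrix_vector_mul(2)[OF \<open>linear f\<close>]])
  have "X = 0" if "A *v X = 0" for X
  proof -
    have nth: "f X $ i = (if i = 0 then (P \<bullet> X) / P $ 0 else X $ i)" for i
      by (simp add: f_def axis_nth')
    have "f X = 0"
      using that A by simp
    then have "P \<bullet> X = 0" "X $ 1 = 0" "X $ 2 = 0" "X $ 3 = 0"
      using nth[of 0] nth[of 1] nth[of 2] nth[of 3] assms by simp_all
    then show "X = 0"
      using assms by (simp add: vec_eq_iff all4 inner_4)
  qed
  then have inv: "invertible A"
    by (simp add: invertible_left_inverse matrix_left_invertible_ker)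
  have "A *v axis 0 1 = axis 0 1"
    using assms by (simp add: A f_def inner_axis axis_nth')
  moreover have "(*v) (ext2 A) ` plane_space P \<subseteq> plane_space (axis 0 1)"
  proof -
    have "(*v) (ext2 A) ` plane_space P = span ((*v) (ext2 A) ` {wedge X Y |X Y. P \<bullet> X = 0 \<and> P \<bullet> Y = 0})"
      unfolding plane_space_def by (rule linear_span_image[OF matrix_vector_mul_linear, symmetric])
    also have "\<dots> \<subseteq> plane_space (axis 0 1)"
      by (rule span_minimal[OF _ subspace_plane_space])
        (auto simp: ext2_wedge plane_space_axis A f_def wedge_nth forall_3 axis_nth')
    finally show ?thesis .
  qed
  ultimately show thesis
    using that inv by blast
qed

text \<open>Two normalisations: A1 is undone to bring the point back to e_0, then A2 moves the image
  of the plane e_0 back while keeping the point. What remains preserves both spaces.\<close>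

lemma similitude_mapping_axis_to_point_space:
  assumes "similitude e B" "(*v) B ` point_space (axis 0 1) = point_space X" "X \<noteq> 0"
  obtains A c where "invertible A" "c \<noteq> 0" "B = c *\<^sub>R ext2 A"
proof -
  let ?e0 = "axis 0 1 :: real^4"
  obtain A1 :: "real^4^4" where A1: "invertible A1" "A1 *v ?e0 = X"
    using exists_invertible_mapping_axis[OF assms(3), where k = 0] .
  define B1 where "B1 = ext2 (matrix_inv A1) ** B"
  have B1: "similitude (det (matrix_inv A1) * e) B1"
    unfolding B1_def by (intro similitude_mult similitude_ext2 invertible_matrix_inv A1(1) assms(1))
  have B_eq: "B = ext2 A1 ** B1"
    by (simp add: B1_def matrix_mul_assoc ext2_inverse[OF A1(1)])
  have "(*v) B1 ` point_space ?e0 = (*v) (ext2 (matrix_inv A1)) ` point_space X"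
    by (simp add: B1_def image_image flip: matrix_vector_mul_assoc assms(2))
  also have "\<dots> = point_space ?e0"
    using A1 by (simp add: ext2_point_space invertible_matrix_inv flip: A1(2))
      (simp add: inv_vec_cancel[OF A1(1)])
  finally have B1_pt: "(*v) B1 ` point_space ?e0 = point_space ?e0" .
  have ne: "?e0 \<noteq> 0"
    by (simp add: axis_eq_0_iff)
  \<comment> \<open>Injectivity of \<open>B1\<close> keeps the two images complementary, which
    forces the second one to be a plane space.\<close>
  have "(*v) B1 ` plane_space ?e0 \<inter> point_space ?e0 \<subseteq> {0}"
  proof -
    have "inj ((*v) B1)"
      using B1 inj_invertible by (auto simp: similitude_def)
    then have "(*v) B1 ` plane_space ?e0 \<inter> point_space ?e0 = (*v) B1 ` (plane_space ?e0 \<inter> point_space ?e0)"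
      by (simp add: image_Int B1_pt)
    also have "plane_space ?e0 \<inter> point_space ?e0 \<subseteq> {0}"
      by (auto simp: plane_space_axis point_space_axis vec_eq_iff all33)
    finally show ?thesis
      by (auto simp: image_subset_iff)
  qed
  then obtain P where P: "(*v) B1 ` plane_space ?e0 = plane_space P" "P $ 0 \<noteq> 0"
    using null_complement_of_axis_point_space similitude_null_three_spaces[OF B1 plane_space_null[OF ne]]
    by blast
  obtain A2 where A2: "invertible A2" "A2 *v ?e0 = ?e0"
    "(*v) (ext2 A2) ` plane_space P \<subseteq> plane_space ?e0"
    using exists_map_to_axis_plane[OF P(2)] .
  define B2 where "B2 = ext2 A2 ** B1"
  have "similitude (det A2 * (det (matrix_inv A1) * e)) B2"
    unfolding B2_def by (intro similitude_mult similitude_ext2 A2(1) B1)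
  moreover have "(*v) B2 ` S = (*v) (ext2 A2) ` (*v) B1 ` S" for S
    by (simp add: B2_def image_image flip: matrix_vector_mul_assoc)
  then have "(*v) B2 ` point_space ?e0 \<subseteq> point_space ?e0" "(*v) B2 ` plane_space ?e0 \<subseteq> plane_space ?e0"
    using A2 by (simp_all add: B1_pt P(1) ext2_point_space)
  ultimately obtain A3 c where A3: "invertible A3" "c \<noteq> 0" "B2 = c *\<^sub>R ext2 A3"
    using similitude_fixing_axis_spaces by blast
  have "B1 = ext2 (matrix_inv A2) ** B2"
    by (simp add: B2_def matrix_mul_assoc ext2_inverse[OF A2(1)])
  then have "B = c *\<^sub>R ext2 (A1 ** matrix_inv A2 ** A3)"
    by (simp add: B_eq A3(3) matrix_scalar_ac ext2_mult matrix_mul_assoc flip: scalar_matrix_assoc)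
  moreover have "invertible (A1 ** matrix_inv A2 ** A3)"
    by (intro invertible_mult A1(1) A2(1) A3(1) invertible_matrix_inv)
  ultimately show thesis
    using that A3(2) by blast
qed

text \<open>Since \<open>ext2\<close> is quadratic, the absolute value of c is absorbed by scaling A
  with its square root; only the sign of c remains. The determinant is read off from the pair
  \<open>E 1\<close>, \<open>E' 1\<close>.\<close>

lemma similitude_unit_scaleR_ext2:
  assumes "similitude e (c *\<^sub>R ext2 A)" "c \<noteq> 0"
  obtains A' where "det A' = e" "c *\<^sub>R ext2 A = ext2 A' \<or> c *\<^sub>R ext2 A = - ext2 A'"
proof -
  define A' where "A' = sqrt \<bar>c\<bar> *\<^sub>R A"
  have eq: "ext2 A' = \<bar>c\<bar> *\<^sub>R ext2 A"
    by (simp add: A'_def ext2_scaleR)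
  then have or: "c *\<^sub>R ext2 A = ext2 A' \<or> c *\<^sub>R ext2 A = - ext2 A'"
    by (simp add: abs_if)
  have "det A' * bform u v = e * bform u v" for u v
  proof -
    have "bform ((c *\<^sub>R ext2 A) *v u) ((c *\<^sub>R ext2 A) *v v) = e * bform u v"
      using assms(1) by (simp add: similitude_def)
    then show ?thesis
      using or unfolding bform_ext2[symmetric]
      by (auto simp: uminus_matrix_vector bilinear_lneg[OF bilinear_bform] bilinear_rneg[OF bilinear_bform])
  qed
  from this[of "E 1" "E' 1"] have "det A' = e"
    by (simp add: bform_basis)
  then show thesis
    using that or by blast
qed

text \<open>The image of the single point e_0 decides the case. If it is a plane,
  \<open>Gram ** B\<close> sends e_0 to a point.\<close>

lemma RL33_cases:
  assumes "B \<in> carrier RL33"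
  obtains A where "det A = 1 \<or> det A = -1" "B = ext2 A \<or> B = - ext2 A"
  | A where "det A = 1 \<or> det A = -1" "B = Gram ** ext2 A \<or> B = - (Gram ** ext2 A)"
proof -
  let ?e0 = "axis 0 1 :: real^4"
  obtain e where e: "e = 1 \<or> e = -1" "similitude e B"
    using assms RL33_iff by blast
  have ne: "?e0 \<noteq> 0"
    by (simp add: axis_eq_0_iff)
  have "(*v) B ` point_space ?e0 \<in> null_three_spaces"
    using similitude_null_three_spaces[OF e(2) point_space_null[OF ne]] .
  then show thesis
  proof (cases rule: null_three_space_cases)
    case (1 X)
    then obtain A c where A: "c \<noteq> 0" "B = c *\<^sub>R ext2 A"
      using similitude_mapping_axis_to_point_space[OF e(2)] by metis
    then show thesis
      using that(1) e similitude_unit_scaleR_ext2 by metis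
  next
    case (2 P)
    have sim: "similitude e (Gram ** B)"
      using similitude_mult[OF similitude_Gram e(2)] by simp
    have "(*v) (Gram ** B) ` point_space ?e0 = (*v) Gram ` (*v) B ` point_space ?e0"
      by (simp add: image_image flip: matrix_vector_mul_assoc)
    then have "(*v) (Gram ** B) ` point_space ?e0 = point_space P"
      using 2 by (simp add: Gram_plane_space)
    then obtain A c where A: "c \<noteq> 0" "Gram ** B = c *\<^sub>R ext2 A"
      using similitude_mapping_axis_to_point_space[OF sim] 2(1) by metis
    then obtain A' where A': "det A' = e" "Gram ** B = ext2 A' \<or> Gram ** B = - ext2 A'"
      using sim similitude_unit_scaleR_ext2 by metis
    moreover have "B = Gram ** (Gram ** B)"
      by (simp add: matrix_mul_assoc Gram_Gram)
    moreover have "Gram ** (- ext2 A') = - (Gram ** ext2 A')"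
      by (simp add: matrix_eq uminus_matrix_vector linear_neg[OF matrix_vector_mul_linear] flip: matrix_vector_mul_assoc)
    ultimately show thesis
      using that(2) e(1) by metis
  qed
qed


section \<open>The action on points and planes\<close>

lemma RL33_mult: "B \<otimes>\<^bsub>RL33\<^esub> C = B ** C"
  and RL33_one: "\<one>\<^bsub>RL33\<^esub> = mat 1"
  by (simp_all add: RL33_def)

lemma det_unit_invertible: "det A = 1 \<or> det A = -1 \<Longrightarrow> invertible A" for A :: "real^'n^'n"
  by (auto simp: invertible_det_nz)

lemma ext2_mem_RL33: "det A = 1 \<or> det A = -1 \<Longrightarrow> ext2 A \<in> carrier RL33"
  using similitude_ext2[OF det_unit_invertible] RL33_iff by metis

lemma Gram_ext2_mem_RL33: "det A = 1 \<or> det A = -1 \<Longrightarrow> Gram ** ext2 A \<in> carrier RL33"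
  using similitude_mult[OF similitude_Gram similitude_ext2[OF det_unit_invertible]] RL33_iff
  by (metis mult_1)

lemma group_RL33: "group RL33"
proof (rule groupI)
  show "\<one>\<^bsub>RL33\<^esub> \<in> carrier RL33"
    using ext2_mem_RL33[of "mat 1"] by (simp add: RL33_one ext2_mat_1)
  fix B assume B: "B \<in> carrier RL33"
  then obtain e where e: "e = 1 \<or> e = -1" "similitude e B"
    using RL33_iff by blast
  then have inv: "invertible B"
    by (simp add: similitude_def)
  show "\<one>\<^bsub>RL33\<^esub> \<otimes>\<^bsub>RL33\<^esub> B = B"
    by (simp add: RL33_mult RL33_one)
  show "\<exists>C\<in>carrier RL33. C \<otimes>\<^bsub>RL33\<^esub> B = \<one>\<^bsub>RL33\<^esub>"
  proof
    \<comment> \<open>The inverse has multiplier 1/e, which equals e for e = 1 and e = -1.\<close>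
    have "bform (matrix_inv B *v u) (matrix_inv B *v v) = e * bform u v" for u v
    proof -
      have "bform u v = e * bform (matrix_inv B *v u) (matrix_inv B *v v)"
        using e(2) unfolding similitude_def by (metis inv_vec_cancel(1))
      then show ?thesis
        using e(1) by auto
    qed
    then have "similitude e (matrix_inv B)"
      using e inv by (auto simp: similitude_def invertible_matrix_inv)
    then show "matrix_inv B \<in> carrier RL33"
      using e(1) RL33_iff by blast
    show "matrix_inv B \<otimes>\<^bsub>RL33\<^esub> B = \<one>\<^bsub>RL33\<^esub>"
      by (simp add: RL33_mult RL33_one matrix_inv_both[OF inv])
  qed
  fix C assume C: "C \<in> carrier RL33"
  show "B \<otimes>\<^bsub>RL33\<^esub> C \<in> carrier RL33"
    using B C similitude_mult by (fastforce simp: RL33_iff RL33_mult)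
  fix D
  show "B \<otimes>\<^bsub>RL33\<^esub> C \<otimes>\<^bsub>RL33\<^esub> D = B \<otimes>\<^bsub>RL33\<^esub> (C \<otimes>\<^bsub>RL33\<^esub> D)"
    by (simp add: RL33_mult matrix_mul_assoc)
qed

lemma RL33_null_three_spaces:
  assumes "B \<in> carrier RL33" "N \<in> null_three_spaces"
  shows "(*v) B ` N \<in> null_three_spaces"
  using assms similitude_null_three_spaces RL33_iff by blast

lemma null_action_Bij:
  assumes B: "B \<in> carrier RL33"
  shows "null_action B \<in> Bij null_three_spaces"
proof -
  have inv: "invertible B"
    using B by (simp add: RL33_def)
  have C: "matrix_inv B \<in> carrier RL33"
  proof -
    obtain C where "C \<in> carrier RL33" "C ** B = mat 1"
      using group.l_inv_ex[OF group_RL33 B] by (auto simp: RL33_def)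
    moreover from this(2) have "matrix_inv B = C"
      using matrix_inv_eqI matrix_left_right_inverse by metis
    ultimately show ?thesis by simp
  qed
  have "bij_betw (null_action B) null_three_spaces null_three_spaces"
  proof (rule bij_betw_byWitness[where f' = "(`) ((*v) (matrix_inv B))"])
    show "null_action B ` null_three_spaces \<subseteq> null_three_spaces"
      "(`) ((*v) (matrix_inv B)) ` null_three_spaces \<subseteq> null_three_spaces"
      using RL33_null_three_spaces B C by (auto simp: null_action_def)
    show "\<forall>N\<in>null_three_spaces. (*v) (matrix_inv B) ` null_action B N = N"
      by (simp add: null_action_def image_image inv_vec_cancel[OF inv])
    show "\<forall>N\<in>null_three_spaces. null_action B ((*v) (matrix_inv B) ` N) = N"
      using RL33_null_three_spaces[OF C]
      by (simp add: null_action_def image_image inv_vec_cancel[OF inv])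
  qed
  then show ?thesis
    by (simp add: Bij_def null_action_def)
qed

lemma group_action_null_action: "group_action RL33 null_three_spaces null_action"
proof -
  have "null_action (B \<otimes>\<^bsub>RL33\<^esub> C) = compose null_three_spaces (null_action B) (null_action C)"
    if "C \<in> carrier RL33" for B C
    using RL33_null_three_spaces[OF that]
    by (auto simp: null_action_def compose_def RL33_mult image_image fun_eq_iff
        simp flip: matrix_vector_mul_assoc)
  then have "null_action \<in> hom RL33 (BijGroup null_three_spaces)"
    by (auto simp: hom_def BijGroup_def null_action_Bij)
  then show ?thesis
    by (simp add: group_action_def group_hom_def group_hom_axioms_def group_RL33 group_BijGroup)
qed

section \<open>The induced map on points and planes\<close>

lemma null_space_of_null: "x \<in> proj_elements \<Longrightarrow> null_space_of x \<in> null_three_spaces"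
  using bij_betw_null_space_of by (auto simp: bij_betw_def)

text \<open>Values of \<open>induced_map\<close> are recognised by their null 3-spaces, so that
  later computations avoid the inverse of \<open>null_space_of\<close>.\<close>

lemma induced_map_eqI:
  assumes "x \<in> proj_elements" "y \<in> proj_elements" "null_space_of y = (*v) B ` null_space_of x"
  shows "induced_map B x = y"
  using assms null_space_of_null[OF assms(1)] bij_betw_null_space_of
  by (simp add: induced_map_def null_action_def bij_betw_def the_inv_into_f_f flip: assms(3))

lemma induced_map_extensional: "induced_map B \<in> extensional proj_elements"
  by (simp add: induced_map_def)

lemma induced_map_closed:
  assumes "B \<in> carrier RL33" "x \<in> proj_elements"
  shows "induced_map B x \<in> proj_elements" "null_space_of (induced_map B x) = (*v) B ` null_space_of x"
proof -
  have "(*v) B ` null_space_of x \<in> null_space_of ` proj_elements"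
    using RL33_null_three_spaces[OF assms(1) null_space_of_null[OF assms(2)]] bij_betw_null_space_of
    by (simp add: bij_betw_def)
  then obtain y where y: "y \<in> proj_elements" "null_space_of y = (*v) B ` null_space_of x"
    by auto
  moreover have "induced_map B x = y"
    using assms(2) y by (rule induced_map_eqI)
  ultimately show "induced_map B x \<in> proj_elements" "null_space_of (induced_map B x) = (*v) B ` null_space_of x"
    by auto
qed

lemma proj_elements_cases:
  assumes "x \<in> proj_elements"
  obtains X where "X \<noteq> 0" "x = point_of X" | P where "P \<noteq> 0" "x = plane_of P"
  using assms by (auto simp: proj_elements_def)

lemma point_of_mem: "X \<noteq> 0 \<Longrightarrow> point_of X \<in> proj_elements"
  and plane_of_mem: "P \<noteq> 0 \<Longrightarrow> plane_of P \<in> proj_elements"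
  by (auto simp: proj_elements_def)

lemma induced_map_ext2:
  assumes "invertible A"
  shows "induced_map (ext2 A) = transformation A"
proof (rule extensionalityI[OF induced_map_extensional])
  show "transformation A \<in> extensional proj_elements"
    by (simp add: transformation_def)
  fix x assume "x \<in> proj_elements"
  then show "induced_map (ext2 A) x = transformation A x"
  proof (cases rule: proj_elements_cases)
    case (1 X)
    then show ?thesis
      using assms
      by (intro induced_map_eqI)
        (simp_all add: transformation_point point_of_mem null_space_of_point_of ext2_point_space
          invertible_vec_eq_0)
  next
    case (2 P)
    then show ?thesis
      using assms invertible_inv_transpose[OF assms]
      by (intro induced_map_eqI)
        (simp_all add: transformation_plane plane_of_mem null_space_of_plane_of ext2_plane_space
          invertible_vec_eq_0)
  qed
qed

lemma induced_map_Gram_ext2: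
  assumes "invertible A"
  shows "induced_map (Gram ** ext2 A) = polarity A"
proof (rule extensionalityI[OF induced_map_extensional])
  show "polarity A \<in> extensional proj_elements"
    by (simp add: polarity_def)
  have image: "(*v) (Gram ** ext2 A) ` S = (*v) Gram ` (*v) (ext2 A) ` S" for S
    by (simp add: image_image flip: matrix_vector_mul_assoc)
  fix x assume "x \<in> proj_elements"
  then show "induced_map (Gram ** ext2 A) x = polarity A x"
  proof (cases rule: proj_elements_cases)
    case (1 X)
    then show ?thesis
      using assms
      by (intro induced_map_eqI)
        (simp_all add: polarity_point point_of_mem plane_of_mem null_space_of_point_of
          null_space_of_plane_of image ext2_point_space Gram_point_space invertible_vec_eq_0)
  next
    case (2 P)
    then show ?thesis
      using assms invertible_inv_transpose[OF assms]
      by (intro induced_map_eqI)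
        (simp_all add: polarity_plane point_of_mem plane_of_mem null_space_of_point_of
          null_space_of_plane_of image ext2_plane_space Gram_plane_space invertible_vec_eq_0)
  qed
qed

lemma induced_map_minus: "induced_map (- B) = induced_map B"
proof -
  have "(*v) (- B) ` N = (*v) B ` N" if "N \<in> null_three_spaces" for N
    using that scaleR_image_subspace[of N "-1" B] by (simp add: null_three_spaces_def)
  then show ?thesis
    using null_space_of_null by (auto simp: induced_map_def null_action_def fun_eq_iff)
qed

lemma minus_mem_RL33: "B \<in> carrier RL33 \<Longrightarrow> - B \<in> carrier RL33"
proof -
  assume "B \<in> carrier RL33"
  moreover have "invertible (- B)" if "invertible B"
  proof -
    have "- B = B ** (- mat 1)"
      by (simp add: matrix_eq uminus_matrix_vector linear_neg[OF matrix_vector_mul_linear] flip: matrix_vector_mul_assoc)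
    moreover have "(- mat 1) ** (- mat 1) = (mat 1 :: real^(3 + 3)^(3 + 3))"
      by (simp add: matrix_eq uminus_matrix_vector flip: matrix_vector_mul_assoc)
    then have "invertible (- mat 1 :: real^(3 + 3)^(3 + 3))"
      by (auto simp: invertible_def)
    ultimately show ?thesis
      using that invertible_mult by metis
  qed
  ultimately show "- B \<in> carrier RL33"
    by (auto simp: RL33_iff similitude_def uminus_matrix_vector bilinear_lneg[OF bilinear_bform]
        bilinear_rneg[OF bilinear_bform])
qed

lemma induced_map_image: "induced_map ` carrier RL33 = carrier PR3"
proof
  show "induced_map ` carrier RL33 \<subseteq> carrier PR3"
  proof
    fix g assume "g \<in> induced_map ` carrier RL33"
    then obtain B where B: "B \<in> carrier RL33" "g = induced_map B"
      by blast
    from B(1) show "g \<in> carrier PR3"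
    proof (cases rule: RL33_cases)
      case (1 A)
      then show ?thesis
        using B(2) induced_map_ext2[OF det_unit_invertible[OF 1(1)]]
        by (auto simp: induced_map_minus PR3_def)
    next
      case (2 A)
      then show ?thesis
        using B(2) induced_map_Gram_ext2[OF det_unit_invertible[OF 2(1)]]
        by (auto simp: induced_map_minus PR3_def)
    qed
  qed
  have "transformation A \<in> induced_map ` carrier RL33" "polarity A \<in> induced_map ` carrier RL33"
    if "det A = 1 \<or> det A = -1" for A
    using induced_map_ext2[OF det_unit_invertible[OF that]] ext2_mem_RL33[OF that]
      induced_map_Gram_ext2[OF det_unit_invertible[OF that]] Gram_ext2_mem_RL33[OF that]
    by (metis imageI)+
  then show "carrier PR3 \<subseteq> induced_map ` carrier RL33"
    by (auto simp: PR3_def)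
qed

lemma induced_map_Bij:
  assumes "B \<in> carrier RL33"
  shows "induced_map B \<in> Bij proj_elements"
proof -
  have "bij_betw (null_action B) null_three_spaces null_three_spaces"
    using null_action_Bij[OF assms] by (simp add: Bij_def)
  then have "bij_betw (the_inv_into proj_elements null_space_of \<circ> (null_action B \<circ> null_space_of))
      proj_elements proj_elements"
    using bij_betw_null_space_of bij_betw_the_inv_into[OF bij_betw_null_space_of]
    by (blast intro: bij_betw_trans)
  then have "bij_betw (induced_map B) proj_elements proj_elements"
    by (rule bij_betw_cong[THEN iffD1, rotated]) (simp add: induced_map_def)
  then show ?thesis
    by (simp add: Bij_def induced_map_extensional)
qed

section \<open>The homomorphism onto \<open>PR3\<close> and its fibres\<close>

lemma group_hom_induced_map: "group_hom RL33 PR3 induced_map"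
proof -
  have "induced_map (B \<otimes>\<^bsub>RL33\<^esub> C) = compose proj_elements (induced_map B) (induced_map C)"
    if "B \<in> carrier RL33" "C \<in> carrier RL33" for B C
  proof (rule extensionalityI[OF induced_map_extensional compose_extensional])
    fix x assume x: "x \<in> proj_elements"
    have "induced_map (B \<otimes>\<^bsub>RL33\<^esub> C) x = induced_map B (induced_map C x)"
      using x that
      by (intro induced_map_eqI)
        (auto simp: induced_map_closed RL33_mult image_image simp flip: matrix_vector_mul_assoc)
    then show "induced_map (B \<otimes>\<^bsub>RL33\<^esub> C) x = compose proj_elements (induced_map B) (induced_map C) x"
      using x by (simp add: compose_eq)
  qed
  then have hom: "induced_map \<in> hom RL33 (BijGroup proj_elements)"
    by (auto simp: hom_def BijGroup_def induced_map_Bij)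
  then interpret B: group_hom RL33 "BijGroup proj_elements" induced_map
    by (simp add: group_hom_def group_hom_axioms_def group_RL33 group_BijGroup)
  have PR3: "PR3 = BijGroup proj_elements \<lparr>carrier := carrier PR3\<rparr>"
    by (simp add: PR3_def)
  \<comment> \<open>As the image of a homomorphism, \<open>PR3\<close> is a group without composing
    transformations and polarities by hand.\<close>
  have "subgroup (carrier PR3) (BijGroup proj_elements)"
    using B.img_is_subgroup by (simp add: induced_map_image)
  then have "group PR3"
    using B.H.subgroup_imp_group PR3 by metis
  moreover have "induced_map \<in> hom RL33 PR3"
    using hom induced_map_image by (auto simp: hom_def PR3_def)
  ultimately show ?thesis
    by (simp add: group_hom_def group_hom_axioms_def group_RL33)
qed

text \<open>Comparing multipliers gives det A' = c^4 det A. Both determinants have absolute value 1,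
  so c^4 = 1 and, c being real, c^2 = 1.\<close>

lemma ext2_eq_if_proportional:
  assumes "A' = c *\<^sub>R A" "det A = 1 \<or> det A = -1" "det A' = 1 \<or> det A' = -1"
  shows "ext2 A' = ext2 A"
proof -
  have eq: "ext2 A' = c\<^sup>2 *\<^sub>R ext2 A"
    by (simp add: assms(1) ext2_scaleR)
  have "bform (ext2 A' *v E 1) (ext2 A' *v E' 1) = (c\<^sup>2 * c\<^sup>2) * bform (ext2 A *v E 1) (ext2 A *v E' 1)"
    by (simp add: eq bilinear_lmul[OF bilinear_bform] bilinear_rmul[OF bilinear_bform] flip: scaleR_matrix_vector_assoc)
  then have "det A' = (c\<^sup>2)\<^sup>2 * det A"
    by (simp add: bform_ext2 bform_basis power2_eq_square)
  moreover have "x = 1" if "det A' = x * det A" "0 \<le> x" for x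
    using that assms(2,3) by auto
  ultimately have "(c\<^sup>2)\<^sup>2 = 1"
    by (metis zero_le_power2)
  then have "c\<^sup>2 = 1"
    using power2_eq_1_iff[of "c\<^sup>2"] zero_le_power2[of c] by linarith
  then show ?thesis
    by (simp add: eq)
qed

text \<open>The polarity case of \<open>RL33_cases\<close> is excluded because it sends points to
  planes. Otherwise the matrices are proportional and have equal exterior squares, which leaves only
  the sign.\<close>

lemma transformation_fibre:
  assumes A: "det A = 1 \<or> det A = -1"
  shows "{B \<in> carrier RL33. induced_map B = transformation A} = {ext2 A, - ext2 A}"
proof
  show "{ext2 A, - ext2 A} \<subseteq> {B \<in> carrier RL33. induced_map B = transformation A}"
    using ext2_mem_RL33[OF A] induced_map_ext2[OF det_unit_invertible[OF A]]
    by (simp add: minus_mem_RL33 induced_map_minus)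
  have "B \<in> {ext2 A, - ext2 A}" if B: "B \<in> carrier RL33" "induced_map B = transformation A" for B
    using B(1)
  proof (cases rule: RL33_cases)
    case (1 A')
    then have "transformation A' = transformation A"
      using B(2) induced_map_ext2[OF det_unit_invertible[OF 1(1)]] by (auto simp: induced_map_minus)
    then obtain c where "A' = c *\<^sub>R A"
      using transformation_eq_iff[OF det_unit_invertible[OF A] det_unit_invertible[OF 1(1)]] by blast
    then have "ext2 A' = ext2 A"
      using A 1(1) by (rule ext2_eq_if_proportional)
    then show ?thesis
      using 1(2) by auto
  next
    case (2 A')
    then have "polarity A' = transformation A"
      using B(2) induced_map_Gram_ext2[OF det_unit_invertible[OF 2(1)]] by (auto simp: induced_map_minus)
    then show ?thesis
      using transformation_neq_polarity by metis
  qed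
  then show "{B \<in> carrier RL33. induced_map B = transformation A} \<subseteq> {ext2 A, - ext2 A}"
    by blast
qed

lemma polarity_fibre:
  assumes A: "det A = 1 \<or> det A = -1"
  shows "{B \<in> carrier RL33. induced_map B = polarity A} = {Gram ** ext2 A, - (Gram ** ext2 A)}"
proof
  show "{Gram ** ext2 A, - (Gram ** ext2 A)} \<subseteq> {B \<in> carrier RL33. induced_map B = polarity A}"
    using Gram_ext2_mem_RL33[OF A] induced_map_Gram_ext2[OF det_unit_invertible[OF A]]
    by (simp add: minus_mem_RL33 induced_map_minus)
  have "B \<in> {Gram ** ext2 A, - (Gram ** ext2 A)}" if B: "B \<in> carrier RL33" "induced_map B = polarity A" for B
    using B(1)
  proof (cases rule: RL33_cases)
    case (1 A')
    then have "transformation A' = polarity A"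
      using B(2) induced_map_ext2[OF det_unit_invertible[OF 1(1)]] by (auto simp: induced_map_minus)
    then show ?thesis
      using transformation_neq_polarity by metis
  next
    case (2 A')
    then have "polarity A' = polarity A"
      using B(2) induced_map_Gram_ext2[OF det_unit_invertible[OF 2(1)]] by (auto simp: induced_map_minus)
    then obtain c where "A' = c *\<^sub>R A"
      using polarity_eq_iff[OF det_unit_invertible[OF A] det_unit_invertible[OF 2(1)]] by blast
    then have "ext2 A' = ext2 A"
      using A 2(1) by (rule ext2_eq_if_proportional)
    then show ?thesis
      using 2(2) by auto
  qed
  then show "{B \<in> carrier RL33. induced_map B = polarity A} \<subseteq> {Gram ** ext2 A, - (Gram ** ext2 A)}"
    by blast
qed

lemma card_pair_minus:
  fixes B :: "real^(3 + 3)^(3 + 3)"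
  assumes "invertible B"
  shows "card {B, - B} = 2"
proof -
  have "B \<noteq> - B"
  proof
    assume "B = - B"
    then have "B *v E 1 = - (B *v E 1)"
      by (metis uminus_matrix_vector)
    then have "B *v E 1 = 0"
      by (simp add: vec_eq_iff)
    then have "E 1 = 0"
      by (simp add: invertible_vec_eq_0[OF assms])
    then show False
      by (simp add: E_def axis_eq_0_iff)
  qed
  then show ?thesis
    by simp
qed

theorem mainTheorem1:
  shows "bij_betw null_space_of proj_elements null_three_spaces \<and>
         group_action RL33 null_three_spaces null_action \<and>
         group_hom RL33 PR3 induced_map \<and>
         induced_map ` carrier RL33 = carrier PR3 \<and>
         (\<forall>g\<in>carrier PR3. card {B \<in> carrier RL33. induced_map B = g} = 2)"
proof (intro conjI ballI)
  fix g assume "g \<in> carrier PR3"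
  then obtain A where A: "det A = 1 \<or> det A = -1" "g = transformation A \<or> g = polarity A"
    by (auto simp: PR3_def)
  have "invertible (ext2 A)" "invertible (Gram ** ext2 A)"
    using invertible_ext2[OF det_unit_invertible[OF A(1)]] invertible_Gram
    by (simp_all add: invertible_mult)
  then show "card {B \<in> carrier RL33. induced_map B = g} = 2"
    using A(2) transformation_fibre[OF A(1)] polarity_fibre[OF A(1)] by (auto simp: card_pair_minus)
qed (rule bij_betw_null_space_of group_action_null_action group_hom_induced_map induced_map_image)+

end
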